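(* Let $d\ge 2$ be an integer, and let $p_c$ and $\tilde p_c$ be the two critical parameters of nearest-neighbour Bernoulli bond percolation on $\mathbb{Z}^d$ defined by $$p_c=\sup\{p\in[0,1] : \mathbb{P}_p[0\longleftrightarrow\infty]=0\},$$ $$\tilde p_c=\sup\{p\in[0,1] : \text{there exists a finite set } S\subset\mathbb{Z}^d \text{ with } 0\in S \text{ and } \varphi_p(S)<1\}.$$ Then $\tilde p_c=p_c$. Furthermore: 1. For every $p\in[0,1]$ with $p<p_c$, there exists $c=c(p)>0$ such that for every integer $n\ge 1$, $$\mathbb{P}_p[0\longleftrightarrow\partial\Lambda_n]\le e^{-cn}.$$ 2. For every $p\in[0,1]$ with $p>p_c$, $$\mathbb{P}_p[0\longleftrightarrow\infty]\ge\frac{p-p_c}{p(1-p_c)}.$$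
   Context: Let $(\mathbb{Z}^d,\mathbb{E}^d)$ be the $d$-dimensional hypercubic lattice, where $\mathbb{E}^d$ is the set of unordered nearest-neighbour pairs $\{x,y\}$ (i.e. $x,y\in\mathbb{Z}^d$ at Euclidean distance $1$). For $p\in[0,1]$, $\mathbb{P}_p$ is the Bernoulli bond percolation (product) measure on $\{0,1\}^{\mathbb{E}^d}$ for which each edge is open with probability $p$ and closed otherwise, independently for different edges. Let $\Lambda_n=\{-n,\ldots,n\}^d$ and $\partial\Lambda_n=\Lambda_n\setminus\Lambda_{n-1}$. For a set $S\subset\mathbb{Z}^d$ and vertices $x,y$, the event $x\stackrel{S}{\longleftrightarrow}y$ ("$x$ and $y$ are connected in $S$") is that there exists a finite path of vertices $(v_k)_{0\le k\le K}$ ($K\ge 0$), all in $S$, such that $v_0=x$, $v_K=y$, and $\{v_k,v_{k+1}\}$ is an open edge of $\mathbb{E}^d$ for every $0\le k<K$. When $S=\mathbb{Z}^d$ it is dropped from the notation. The event $0\longleftrightarrow\partial\Lambda_n$ means that $0$ is connected (in $\mathbb{Z}^d$) to some vertex of $\partial\Lambda_n$; the event $0\longleftrightarrow\infty$ means that $0$ is connected to infinity, i.e. that the set of vertices connected to $0$ is infinite. For a finite set $S\subset\mathbb{Z}^d$ containing $0$, the edge-boundary $\Delta S$ is the set of all edges $\{x,y\}\in\mathbb{E}^d$ with $x\in S$ and $y\notin S$, and $$\varphi_p(S):=p\sum_{\{x,y\}\in\Delta S}\mathbb{P}_p\big[0\stackrel{S}{\longleftrightarrow}x\big],$$ where in each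 term $x$ denotes the endpoint of the edge lying in $S$. *)

theory Defs
  imports "HOL-Analysis.Analysis" "HOL-Probability.Probability"
begin

text \<open>
  The vertices of the lattice are the points of \<open>int ^ 'd\<close>, where \<open>CARD('d)\<close> is the dimension.
\<close>

definition embed :: "int ^ 'd::finite \<Rightarrow> real ^ 'd" where
  "embed x = (\<chi> i. real_of_int (x $ i))"

definition lattice_edges :: "(int ^ 'd::finite) set set" where
  "lattice_edges = {{x, y} | x y. dist (embed x) (embed y) = 1}"

text \<open>A configuration maps an edge to \<open>True\<close> if it is open and to \<open>False\<close> if it is closed.\<close>

type_synonym 'd configuration = "(int ^ 'd) set \<Rightarrow> bool"

definition percolation :: "real \<Rightarrow> 'd::finite configuration measure" where
  "percolation p = PiM lattice_edges (\<lambda>_. measure_pmf (bernoulli_pmf p))"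

definition percolation_prob :: "real \<Rightarrow> ('d::finite configuration \<Rightarrow> bool) \<Rightarrow> real" where
  "percolation_prob p A = measure (percolation p) {\<omega> \<in> space (percolation p). A \<omega>}"

text \<open>
  The condition \<open>{v k, v (Suc k)} \<in> lattice_edges\<close> cannot be dropped: the value of \<open>\<omega>\<close> at a set that
  is not an edge is \<open>undefined\<close>.
\<close>

definition connected_in ::
    "'d::finite configuration \<Rightarrow> (int ^ 'd) set \<Rightarrow> int ^ 'd \<Rightarrow> int ^ 'd \<Rightarrow> bool" where
  "connected_in \<omega> S x y \<longleftrightarrow>
     (\<exists>(K::nat) v. (\<forall>k\<le>K. v k \<in> S) \<and> v 0 = x \<and> v K = y \<and>
        (\<forall>k<K. {v k, v (Suc k)} \<in> lattice_edges \<and> \<omega> {v k, v (Suc k)}))"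

definition lattice_box :: "nat \<Rightarrow> (int ^ 'd::finite) set" where
  "lattice_box n = {x. \<forall>i. x $ i \<in> {- int n..int n}}"

text \<open>Only meaningful for \<open>n \<ge> 1\<close>; for \<open>n = 0\<close> the truncated subtraction makes this set empty.\<close>

definition box_boundary :: "nat \<Rightarrow> (int ^ 'd::finite) set" where
  "box_boundary n = lattice_box n - lattice_box (n - 1)"

definition connected_to_boundary :: "nat \<Rightarrow> 'd::finite configuration \<Rightarrow> bool" where
  "connected_to_boundary n \<omega> \<longleftrightarrow> (\<exists>x\<in>box_boundary n. connected_in \<omega> UNIV 0 x)"

definition connected_to_infinity :: "'d::finite configuration \<Rightarrow> bool" where
  "connected_to_infinity \<omega> \<longleftrightarrow> infinite {x. connected_in \<omega> UNIV 0 x}"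

definition edge_boundary :: "(int ^ 'd::finite) set \<Rightarrow> (int ^ 'd) set set" where
  "edge_boundary S = {{x, y} | x y. {x, y} \<in> lattice_edges \<and> x \<in> S \<and> y \<notin> S}"

text \<open>An edge of the edge-boundary of \<open>S\<close> has exactly one endpoint in \<open>S\<close>.\<close>

definition phi :: "real \<Rightarrow> (int ^ 'd::finite) set \<Rightarrow> real" where
  "phi p S = p * (\<Sum>e\<in>edge_boundary S.
     percolation_prob p (\<lambda>\<omega>. connected_in \<omega> S 0 (THE x. x \<in> e \<and> x \<in> S)))"

definition p_c :: "'d::finite itself \<Rightarrow> real" where
  "p_c _ = Sup {p \<in> {0..1}.
     percolation_prob p (connected_to_infinity :: 'd configuration \<Rightarrow> bool) = 0}"

definition p_c_tilde :: "'d::finite itself \<Rightarrow> real" where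
  "p_c_tilde _ = Sup {p \<in> {0..1}. \<exists>S :: (int ^ 'd) set. finite S \<and> 0 \<in> S \<and> phi p S < 1}"

end

theory Submission
  imports Defs "HOL-Real_Asymp.Real_Asymp"
begin

text \<open>
  The proof follows the argument of Duminil-Copin and Tassion. Write \<open>\<theta> m p\<close> for the probability that
  the origin is connected to the outside of the box of radius \<open>m\<close> (\<open>leave_prob\<close> below). It is a
  polynomial in \<open>p\<close>, and it decreases to the probability of an infinite cluster as \<open>m\<close> grows.

  Below \<open>p_c_tilde\<close> there is a finite \<open>S\<close> containing the origin with \<open>phi p S < 1\<close>, because \<open>phi\<close> is nondecreasing in \<open>p\<close>
  (\<open>phi_mono\<close>). Every path from the origin to a distant place has to leave the cluster of the origin
  in \<open>S\<close>. Conditioning on this cluster and on the edge of the last exit gives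
  \<open>\<theta> (m + L) p \<le> phi p S * \<theta> m p\<close>, where \<open>L\<close> exceeds the radius of \<open>S\<close> (\<open>exit_inequality\<close>,
  \<open>leave_prob_recursion\<close>), and hence exponential decay.

  Above \<open>p_c_tilde\<close> all finite \<open>S\<close> containing the origin satisfy \<open>phi p S \<ge> 1\<close>. Conditioning on the
  set of vertices not connected to the boundary of a box, and counting closed pivotal edges, one
  finds \<open>p * (1 - p) * \<theta>' \<ge> 1 - \<theta>\<close>, where \<open>\<theta>'\<close> is the derivative in \<open>p\<close> (\<open>influence_inequality\<close>,
  \<open>leave_prob_has_derivative\<close>). Integrating from \<open>p_c_tilde\<close> to \<open>p\<close> gives the lower bound
  \<open>(p - p_c_tilde) / (p * (1 - p_c_tilde))\<close> for \<open>\<theta> m p\<close>, uniformly in \<open>m\<close>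
  (\<open>leave_prob_lower_bound\<close>), and it passes to the limit.

  So the probability of an infinite cluster vanishes below \<open>p_c_tilde\<close> and is positive above, which
  means that \<open>p_c_tilde = p_c\<close>.

  All estimates are made for finitely many edges, where expectations are finite sums;
  \<open>percolation_finite_range\<close> transfers them to the product measure on the whole lattice.
\<close>

section \<open>Bernoulli percolation on a finite edge set\<close>

text \<open>
  The expectation of \<open>f\<close> when every edge of the finite set \<open>E\<close> is open with probability \<open>p\<close>,
  independently. Here a configuration is the set \<open>\<omega> \<subseteq> E\<close> of its open edges. The definition makes
  sense as a polynomial in every real \<open>p\<close>, so that it can be differentiated without restricting
  \<open>p\<close> to the unit interval.
\<close>

definition Ex_perc :: "real \<Rightarrow> 'e set \<Rightarrow> ('e set \<Rightarrow> real) \<Rightarrow> real" where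
  "Ex_perc p E f = (\<Sum>\<omega>\<in>Pow E. (\<Prod>e\<in>E. if e \<in> \<omega> then p else 1 - p) * f \<omega>)"

text \<open>
  The probability of an event, as the expectation of its indicator.
\<close>

abbreviation Pr_perc :: "real \<Rightarrow> 'e set \<Rightarrow> ('e set \<Rightarrow> bool) \<Rightarrow> real" where
  "Pr_perc p E A \<equiv> Ex_perc p E (\<lambda>\<omega>. of_bool (A \<omega>))"

lemma Ex_perc_empty [simp]: "Ex_perc p {} f = f {}"
  by (simp add: Ex_perc_def)

lemma Ex_perc_cong: "(\<And>\<omega>. \<omega> \<subseteq> E \<Longrightarrow> f \<omega> = g \<omega>) \<Longrightarrow> Ex_perc p E f = Ex_perc p E g"
  by (simp add: Ex_perc_def)

lemma Ex_perc_diff: "Ex_perc p E (\<lambda>\<omega>. f \<omega> - g \<omega>) = Ex_perc p E f - Ex_perc p E g"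
  by (simp add: Ex_perc_def algebra_simps sum_subtractf)

lemma Ex_perc_cmult: "Ex_perc p E (\<lambda>\<omega>. c * f \<omega>) = c * Ex_perc p E f"
  by (simp add: Ex_perc_def algebra_simps sum_distrib_left)

lemma Ex_perc_sum: "Ex_perc p E (\<lambda>\<omega>. \<Sum>i\<in>I. f i \<omega>) = (\<Sum>i\<in>I. Ex_perc p E (f i))"
  by (simp add: Ex_perc_def sum_distrib_left) (rule sum.swap)

lemma Ex_perc_mono:
  assumes "0 \<le> p" "p \<le> 1" "\<And>\<omega>. \<omega> \<subseteq> E \<Longrightarrow> f \<omega> \<le> g \<omega>"
  shows "Ex_perc p E f \<le> Ex_perc p E g"
  unfolding Ex_perc_def using assms by (intro sum_mono mult_left_mono prod_nonneg) auto

lemma Pr_perc_nonneg: "0 \<le> p \<Longrightarrow> p \<le> 1 \<Longrightarrow> 0 \<le> Pr_perc p E A"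
  unfolding Ex_perc_def by (intro sum_nonneg mult_nonneg_nonneg prod_nonneg) auto

text \<open>
  Conditioning on the state of one edge. Most properties of the expectation follow from this by
  induction on the edge set.
\<close>

lemma Ex_perc_insert:
  assumes "finite E" "e \<notin> E"
  shows "Ex_perc p (insert e E) f = p * Ex_perc p E (\<lambda>\<omega>. f (insert e \<omega>)) + (1 - p) * Ex_perc p E f"
proof -
  let ?w = "\<lambda>E \<omega>. \<Prod>x\<in>E. if x \<in> \<omega> then p else 1 - p"
  have inj: "inj_on (insert e) (Pow E)"
    using assms(2) by (auto simp: inj_on_def)
  have disj: "Pow E \<inter> insert e ` Pow E = {}"
    using assms(2) by auto
  have "Ex_perc p (insert e E) f
      = (\<Sum>\<omega>\<in>Pow E. ?w (insert e E) \<omega> * f \<omega>)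
        + (\<Sum>\<omega>\<in>Pow E. ?w (insert e E) (insert e \<omega>) * f (insert e \<omega>))"
    unfolding Ex_perc_def Pow_insert
    using assms(1) disj by (subst sum.union_disjoint) (auto simp: sum.reindex[OF inj])
  also have "(\<Sum>\<omega>\<in>Pow E. ?w (insert e E) \<omega> * f \<omega>) = (\<Sum>\<omega>\<in>Pow E. (1 - p) * (?w E \<omega> * f \<omega>))"
    using assms by (intro sum.cong) auto
  also have "(\<Sum>\<omega>\<in>Pow E. ?w (insert e E) (insert e \<omega>) * f (insert e \<omega>))
      = (\<Sum>\<omega>\<in>Pow E. p * (?w E \<omega> * f (insert e \<omega>)))"
  proof (intro sum.cong refl)
    fix \<omega>
    have "?w E (insert e \<omega>) = ?w E \<omega>"
      using assms(2) by (intro prod.cong) auto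
    then show "?w (insert e E) (insert e \<omega>) * f (insert e \<omega>) = p * (?w E \<omega> * f (insert e \<omega>))"
      using assms by simp
  qed
  finally show ?thesis
    by (simp add: Ex_perc_def sum_distrib_left)
qed

lemma Ex_perc_const [simp]: "finite E \<Longrightarrow> Ex_perc p E (\<lambda>_. c) = c"
  by (induction E rule: finite_induct) (auto simp: Ex_perc_insert algebra_simps)

lemma Ex_perc_union:
  assumes "finite F" "finite H" "F \<inter> H = {}"
  shows "Ex_perc p (F \<union> H) (\<lambda>\<omega>. f (\<omega> \<inter> F) * g (\<omega> \<inter> H)) = Ex_perc p F f * Ex_perc p H g"
  using assms(1,3)
proof (induction F arbitrary: f rule: finite_induct)
  case empty
  have "Ex_perc p H (\<lambda>\<omega>. f {} * g (\<omega> \<inter> H)) = Ex_perc p H (\<lambda>\<omega>. f {} * g \<omega>)"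
    by (rule Ex_perc_cong) (simp add: Int_absorb2)
  then show ?case by (simp add: Ex_perc_cmult)
next
  case (insert e F)
  have e: "e \<notin> F \<union> H" and disj: "F \<inter> H = {}"
    using insert by auto
  have "Ex_perc p (insert e (F \<union> H)) (\<lambda>\<omega>. f (\<omega> \<inter> insert e F) * g (\<omega> \<inter> H))
      = p * Ex_perc p (F \<union> H)
            (\<lambda>\<omega>. f (insert e \<omega> \<inter> insert e F) * g (insert e \<omega> \<inter> H))
        + (1 - p) * Ex_perc p (F \<union> H) (\<lambda>\<omega>. f (\<omega> \<inter> insert e F) * g (\<omega> \<inter> H))"
    using insert.hyps assms(2) e by (subst Ex_perc_insert) auto
  also have "Ex_perc p (F \<union> H) (\<lambda>\<omega>. f (insert e \<omega> \<inter> insert e F) * g (insert e \<omega> \<inter> H))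
      = Ex_perc p (F \<union> H) (\<lambda>\<omega>. f (insert e (\<omega> \<inter> F)) * g (\<omega> \<inter> H))"
    using insert.prems by (intro Ex_perc_cong arg_cong2[where f = "(*)"] arg_cong[where f = f]
        arg_cong[where f = g]) auto
  also have "\<dots> = Ex_perc p F (\<lambda>\<omega>. f (insert e \<omega>)) * Ex_perc p H g"
    by (rule insert.IH[OF disj])
  also have "Ex_perc p (F \<union> H) (\<lambda>\<omega>. f (\<omega> \<inter> insert e F) * g (\<omega> \<inter> H))
      = Ex_perc p (F \<union> H) (\<lambda>\<omega>. f (\<omega> \<inter> F) * g (\<omega> \<inter> H))"
    using e by (intro Ex_perc_cong arg_cong2[where f = "(*)"] arg_cong[where f = f]) auto
  also have "\<dots> = Ex_perc p F f * Ex_perc p H g"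
    by (rule insert.IH[OF disj])
  finally show ?case
    using insert.hyps by (simp add: Ex_perc_insert algebra_simps)
qed

text \<open>
  The expectation of an observable that only depends on the edges in \<open>F\<close> can be computed in \<open>F\<close>.
\<close>

lemma Ex_perc_marginal:
  assumes "finite E" "F \<subseteq> E" "\<And>\<omega>. \<omega> \<subseteq> E \<Longrightarrow> f (\<omega> \<inter> F) = f \<omega>"
  shows "Ex_perc p E f = Ex_perc p F f"
proof -
  have fin: "finite F" "finite (E - F)"
    using assms finite_subset by auto
  have "Ex_perc p E f = Ex_perc p (F \<union> (E - F)) (\<lambda>\<omega>. f (\<omega> \<inter> F) * (\<lambda>_. 1) (\<omega> \<inter> (E - F)))"
    using assms by (subst Un_Diff_cancel) (auto simp: Un_absorb1 intro: Ex_perc_cong)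
  also have "\<dots> = Ex_perc p F f * Ex_perc p (E - F) (\<lambda>_. 1)"
    using fin by (intro Ex_perc_union) auto
  finally show ?thesis
    using fin by simp
qed

lemma Ex_perc_indep:
  assumes "finite E" "F \<subseteq> E" "H \<subseteq> E" "F \<inter> H = {}"
    and f: "\<And>\<omega>. \<omega> \<subseteq> E \<Longrightarrow> f (\<omega> \<inter> F) = f \<omega>"
    and g: "\<And>\<omega>. \<omega> \<subseteq> E \<Longrightarrow> g (\<omega> \<inter> H) = g \<omega>"
  shows "Ex_perc p E (\<lambda>\<omega>. f \<omega> * g \<omega>) = Ex_perc p E f * Ex_perc p E g"
proof -
  have fin: "finite F" "finite H"
    using assms(1-3) by (auto intro: finite_subset)
  have 1: "\<omega> \<inter> (F \<union> H) \<inter> F = \<omega> \<inter> F" "\<omega> \<inter> (F \<union> H) \<inter> H = \<omega> \<inter> H" for \<omega>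
    by auto
  have "Ex_perc p E (\<lambda>\<omega>. f \<omega> * g \<omega>) = Ex_perc p E (\<lambda>\<omega>. f (\<omega> \<inter> F) * g (\<omega> \<inter> H))"
    using f g by (auto intro: Ex_perc_cong)
  also have "\<dots> = Ex_perc p (F \<union> H) (\<lambda>\<omega>. f (\<omega> \<inter> F) * g (\<omega> \<inter> H))"
    using assms(1-3) 1 by (intro Ex_perc_marginal) auto
  also have "\<dots> = Ex_perc p F f * Ex_perc p H g"
    using fin assms(4) by (intro Ex_perc_union)
  also have "\<dots> = Ex_perc p E f * Ex_perc p E g"
    using assms by (simp add: Ex_perc_marginal)
  finally show ?thesis .
qed

lemma Pr_perc_empty: "finite E \<Longrightarrow> Pr_perc p E (\<lambda>\<omega>. \<omega> = {}) = (1 - p) ^ card E"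
  by (induction E rule: finite_induct) (auto simp: Ex_perc_insert)

lemma Pr_perc_edge_open:
  assumes "finite E" "e \<in> E"
  shows "Pr_perc p E (\<lambda>\<omega>. e \<in> \<omega>) = p"
proof -
  have "Pr_perc p E (\<lambda>\<omega>. e \<in> \<omega>) = Pr_perc p (insert e {}) (\<lambda>\<omega>. e \<in> \<omega>)"
    using assms by (intro Ex_perc_marginal) auto
  then show ?thesis
    by (subst (asm) Ex_perc_insert) auto
qed

lemma Ex_perc_image:
  assumes "finite E" "inj_on h E"
  shows "Ex_perc p (h ` E) f = Ex_perc p E (\<lambda>\<omega>. f (h ` \<omega>))"
  using assms
proof (induction E arbitrary: f rule: finite_induct)
  case (insert e E)
  then have "h e \<notin> h ` E" "inj_on h E"
    by auto
  then show ?case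
    using insert by (simp add: Ex_perc_insert del: image_insert) (simp add: Ex_perc_insert insert.IH)
qed simp

text \<open>
  The discrete derivative of the observable \<open>f\<close> at the edge \<open>e\<close>, averaged over the configurations.
  For the indicator of an increasing event this is the probability that \<open>e\<close> is pivotal.
\<close>

definition influence :: "real \<Rightarrow> 'e set \<Rightarrow> ('e set \<Rightarrow> real) \<Rightarrow> 'e \<Rightarrow> real" where
  "influence p E f e = Ex_perc p E (\<lambda>\<omega>. f (insert e \<omega>) - f (\<omega> - {e}))"

text \<open>
  Russo's formula.
\<close>

lemma Ex_perc_has_derivative:
  assumes "finite E"
  shows "((\<lambda>p. Ex_perc p E f) has_real_derivative (\<Sum>e\<in>E. influence p E f e)) (at p)"
  using assms
proof (induction E arbitrary: f rule: finite_induct)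
  case (insert e E)
  let ?f = "\<lambda>\<omega>. f (insert e \<omega>)"
  have 1: "influence p (insert e E) f e' = p * influence p E ?f e' + (1 - p) * influence p E f e'"
    if "e' \<in> E" for e'
  proof -
    have "insert e (\<omega> - {e'}) = insert e \<omega> - {e'}" "insert e' (insert e \<omega>) = insert e (insert e' \<omega>)" for \<omega>
      using that insert.hyps by auto
    then show ?thesis
      using insert.hyps by (simp add: influence_def Ex_perc_insert)
  qed
  have 2: "influence p (insert e E) f e = Ex_perc p E ?f - Ex_perc p E f"
  proof -
    have "influence p (insert e E) f e = Ex_perc p E (\<lambda>\<omega>. f (insert e \<omega>) - f (\<omega> - {e}))"
      using insert.hyps by (simp add: influence_def Ex_perc_insert algebra_simps)
    also have "\<dots> = Ex_perc p E (\<lambda>\<omega>. f (insert e \<omega>) - f \<omega>)"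
    proof (rule Ex_perc_cong)
      fix \<omega> assume "\<omega> \<subseteq> E"
      then have "\<omega> - {e} = \<omega>"
        using insert.hyps by auto
      then show "f (insert e \<omega>) - f (\<omega> - {e}) = f (insert e \<omega>) - f \<omega>"
        by simp
    qed
    finally show ?thesis by (simp add: Ex_perc_diff)
  qed
  have 3: "(\<Sum>e'\<in>insert e E. influence p (insert e E) f e') = Ex_perc p E ?f - Ex_perc p E f
      + (p * (\<Sum>e'\<in>E. influence p E ?f e') + (1 - p) * (\<Sum>e'\<in>E. influence p E f e'))"
    using insert.hyps 1 2 by (simp add: sum.distrib sum_distrib_left)
  have "((\<lambda>p. p * Ex_perc p E ?f + (1 - p) * Ex_perc p E f) has_real_derivative
      (\<Sum>e'\<in>insert e E. influence p (insert e E) f e')) (at p)"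
    by (rule derivative_eq_intros insert.IH refl)+
      (simp add: 3 algebra_simps)
  then show ?case
    using insert.hyps by (simp add: Ex_perc_insert)
qed simp

lemma Ex_perc_mono_param:
  assumes "finite E" "mono_on (Pow E) f" "0 \<le> p" "p \<le> q" "q \<le> 1"
  shows "Ex_perc p E f \<le> Ex_perc q E f"
proof (rule DERIV_nonneg_imp_nondecreasing[OF \<open>p \<le> q\<close>])
  fix r assume r: "p \<le> r" "r \<le> q"
  have "0 \<le> influence r E f e" if "e \<in> E" for e
  proof -
    have "Ex_perc r E (\<lambda>_. 0) \<le> influence r E f e"
      unfolding influence_def using r assms that
      by (intro Ex_perc_mono) (auto intro!: mono_onD[OF assms(2)])
    then show ?thesis using assms(1) by simp
  qed
  then have "0 \<le> (\<Sum>e\<in>E. influence r E f e)"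
    by (rule sum_nonneg)
  then show "\<exists>y. ((\<lambda>p. Ex_perc p E f) has_real_derivative y) (at r) \<and> 0 \<le> y"
    using Ex_perc_has_derivative[OF assms(1)] by blast
qed

text \<open>
  Whether \<open>e\<close> is pivotal does not depend on the state of \<open>e\<close>, so multiplying by \<open>1 - p\<close> amounts to
  requiring in addition that \<open>e\<close> be closed.
\<close>

lemma influence_closed_pivotal:
  assumes "finite E" "e \<in> E" and mono: "\<And>\<omega> \<omega>'. \<omega> \<subseteq> \<omega>' \<Longrightarrow> \<omega>' \<subseteq> E \<Longrightarrow> A \<omega> \<Longrightarrow> A \<omega>'"
  shows "(1 - p) * influence p E (\<lambda>\<omega>. of_bool (A \<omega>)) e = Pr_perc p E (\<lambda>\<omega>. \<not> A \<omega> \<and> A (insert e \<omega>))"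
proof -
  define F where "F = E - {e}"
  have E: "E = insert e F" "e \<notin> F" "finite F"
    using assms by (auto simp: F_def)
  have D: "\<omega> - {e} = \<omega>" if "\<omega> \<subseteq> F" for \<omega>
    using that E by auto
  have "influence p E (\<lambda>\<omega>. of_bool (A \<omega>)) e
      = Ex_perc p F (\<lambda>\<omega>. of_bool (A (insert e \<omega>)) - of_bool (A (\<omega> - {e})))"
    using E by (simp add: influence_def Ex_perc_insert algebra_simps)
  also have "\<dots> = Pr_perc p F (\<lambda>\<omega>. \<not> A \<omega> \<and> A (insert e \<omega>))"
  proof (rule Ex_perc_cong)
    fix \<omega> assume w: "\<omega> \<subseteq> F"
    have "A \<omega> \<Longrightarrow> A (insert e \<omega>)"
      using mono[of \<omega> "insert e \<omega>"] w E by auto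
    then show "(of_bool (A (insert e \<omega>)) :: real) - of_bool (A (\<omega> - {e})) = of_bool (\<not> A \<omega> \<and> A (insert e \<omega>))"
      unfolding D[OF w] by (cases "A \<omega>") simp_all
  qed
  finally show ?thesis
    using E by (simp add: Ex_perc_insert)
qed

section \<open>Connections inside a vertex set\<close>

text \<open>
  \<open>conn \<omega> S x y\<close>: there is a path from \<open>x\<close> to \<open>y\<close> that uses only vertices of \<open>S\<close> and edges of \<open>\<omega>\<close>.
  The graph is arbitrary; an edge is the set of its two endpoints.
\<close>

inductive conn :: "'v set set \<Rightarrow> 'v set \<Rightarrow> 'v \<Rightarrow> 'v \<Rightarrow> bool" for \<omega> S x where
  conn_refl: "x \<in> S \<Longrightarrow> conn \<omega> S x x"
| conn_step: "conn \<omega> S x y \<Longrightarrow> z \<in> S \<Longrightarrow> {y, z} \<in> \<omega> \<Longrightarrow> conn \<omega> S x z"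

lemma conn_in: "conn \<omega> S x y \<Longrightarrow> x \<in> S \<and> y \<in> S"
  by (induction rule: conn.induct) auto

lemma conn_mono: "conn \<omega> S x y \<Longrightarrow> \<omega> \<subseteq> \<omega>' \<Longrightarrow> S \<subseteq> S' \<Longrightarrow> conn \<omega>' S' x y"
  by (induction rule: conn.induct) (auto intro: conn.intros)

lemma conn_trans: "conn \<omega> S y z \<Longrightarrow> conn \<omega> S x y \<Longrightarrow> conn \<omega> S x z"
  by (induction rule: conn.induct) (auto intro: conn.intros)

lemma conn_sym: "conn \<omega> S x y \<Longrightarrow> conn \<omega> S y x"
proof (induction rule: conn.induct)
  case (conn_step y z)
  have "conn \<omega> S z y"
    using conn_step conn_in by (metis conn.intros insert_commute)
  then show ?case
    using conn_step.IH conn_trans by metis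
qed (auto intro: conn.intros)

lemma conn_restrict_edges: "conn (\<omega> \<inter> {e. e \<subseteq> S}) S x y \<longleftrightarrow> conn \<omega> S x y"
proof
  assume "conn \<omega> S x y"
  then show "conn (\<omega> \<inter> {e. e \<subseteq> S}) S x y"
  proof (induction rule: conn.induct)
    case (conn_step y z)
    then show ?case
      using conn_in[OF conn_step.hyps(1)] by (intro conn.conn_step[OF conn_step.IH]) auto
  qed (auto intro: conn.intros)
qed (auto elim: conn_mono)

lemma conn_image:
  "conn \<omega> S x y \<Longrightarrow> conn ((`) t ` \<omega>) (t ` S) (t x) (t y)"
proof (induction rule: conn.induct)
  case (conn_step y z)
  moreover have "{t y, t z} \<in> (`) t ` \<omega>"
    using conn_step by (intro image_eqI[of _ _ "{y, z}"]) auto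
  ultimately show ?case
    by (auto intro: conn.intros)
qed (auto intro: conn.intros)

text \<open>
  A path that starts in \<open>C\<close> and ends outside never returns to \<open>C\<close> after its last step out of \<open>C\<close>.
\<close>

lemma conn_last_exit:
  assumes "conn \<omega> U x z" "x \<in> C" "z \<notin> C"
  obtains a b where "a \<in> C" "b \<notin> C" "{a, b} \<in> \<omega>" "conn \<omega> (U - C) b z"
proof -
  have "z \<notin> C \<Longrightarrow> \<exists>a b. a \<in> C \<and> b \<notin> C \<and> {a, b} \<in> \<omega> \<and> conn \<omega> (U - C) b z"
    using assms(1)
  proof (induction rule: conn.induct)
    case (conn_step y z)
    then show ?case
      by (cases "y \<in> C") (blast intro: conn.intros)+
  qed (use assms(2) in auto)
  then show ?thesis using that assms(3) by blast
qed

text \<open>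
  The set of all vertices that are connected in \<open>S\<close> to some vertex of \<open>X\<close>.
\<close>

definition reach :: "'v set set \<Rightarrow> 'v set \<Rightarrow> 'v set \<Rightarrow> 'v set" where
  "reach \<omega> S X = {y. \<exists>x\<in>X. conn \<omega> S x y}"

lemma reach_subset: "reach \<omega> S X \<subseteq> S"
  by (auto simp: reach_def dest: conn_in)

text \<open>
  The event that the cluster of \<open>X\<close> in \<open>S\<close> is exactly \<open>C\<close> depends only on the edges inside \<open>S\<close> that
  meet \<open>C\<close>. Both conditioning arguments below rest on this.
\<close>

lemma reach_local:
  assumes "\<omega> \<subseteq> G"
  shows "reach (\<omega> \<inter> {e\<in>G. e \<subseteq> S \<and> e \<inter> C \<noteq> {}}) S X = C \<longleftrightarrow> reach \<omega> S X = C"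
    (is "reach ?\<omega> S X = C \<longleftrightarrow> _")
proof
  assume C: "reach \<omega> S X = C"
  have "y \<in> reach ?\<omega> S X" if "conn \<omega> S x y" "x \<in> X" for x y
    using that
  proof (induction rule: conn.induct)
    case (conn_step y z)
    have y: "y \<in> C" "y \<in> S"
      using conn_step.hyps conn_step.prems C by (auto simp: reach_def dest: conn_in)
    then have "{y, z} \<in> ?\<omega>"
      using conn_step.hyps assms by auto
    then show ?case
      using conn_step by (auto simp: reach_def intro: conn.intros)
  qed (auto simp: reach_def intro: conn.intros)
  then have "C \<subseteq> reach ?\<omega> S X"
    using C by (auto simp: reach_def)
  moreover have "reach ?\<omega> S X \<subseteq> C"
    unfolding C[symmetric] by (auto simp: reach_def intro: conn_mono)
  ultimately show "reach ?\<omega> S X = C" by auto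
next
  assume C: "reach ?\<omega> S X = C"
  have "y \<in> reach ?\<omega> S X" if "conn \<omega> S x y" "x \<in> X" for x y
    using that
  proof (induction rule: conn.induct)
    case (conn_step y z)
    have y: "y \<in> C" "y \<in> S"
      using conn_step C by (auto dest: conn_in)
    then have "{y, z} \<in> ?\<omega>"
      using conn_step.hyps assms by auto
    then show ?case
      using conn_step by (auto simp: reach_def intro: conn.intros)
  qed (auto simp: reach_def intro: conn.intros)
  then have "reach \<omega> S X \<subseteq> C"
    using C by (auto simp: reach_def)
  moreover have "reach ?\<omega> S X \<subseteq> reach \<omega> S X"
    by (auto simp: reach_def intro: conn_mono)
  ultimately show "reach \<omega> S X = C"
    using C by auto
qed

section \<open>The two inequalities on a finite graph\<close>

text \<open>
  The edges of \<open>G\<close> that leave \<open>S\<close>, oriented from the endpoint in \<open>S\<close> to the endpoint outside.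
\<close>

definition bd_pairs :: "'v set set \<Rightarrow> 'v set \<Rightarrow> ('v \<times> 'v) set" where
  "bd_pairs G S = {(x, y). {x, y} \<in> G \<and> x \<in> S \<and> y \<notin> S}"

lemma bd_pairs_finite:
  assumes "finite G"  shows "finite (bd_pairs G S)"
proof -
  have "inj_on (\<lambda>(x, y). {x, y}) (bd_pairs G S)"
    by (auto simp: inj_on_def bd_pairs_def doubleton_eq_iff)
  moreover have "(\<lambda>(x, y). {x, y}) ` bd_pairs G S \<subseteq> G"
    by (auto simp: bd_pairs_def)
  ultimately show ?thesis
    using assms by (metis finite_imageD finite_subset)
qed

text \<open>
  Let \<open>C\<close> be the cluster of \<open>r\<close> in \<open>S\<close>. An open path from \<open>r\<close> to \<open>B\<close> leaves \<open>C\<close> for the last time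
  along an edge \<open>{x, y}\<close>; then \<open>y\<close> lies outside \<open>S\<close>, and \<open>y\<close> is connected to \<open>B\<close> off \<open>C\<close>. For
  fixed \<open>C\<close>, the cluster, the edge \<open>{x, y}\<close> and the connection from \<open>y\<close> to \<open>B\<close> involve three disjoint
  sets of edges, so the probabilities multiply. Summing over \<open>C\<close> containing \<open>x\<close> gives the claim.
\<close>

lemma exit_inequality:
  assumes p: "0 \<le> p" "p \<le> 1" and G: "finite G" and S: "finite S" "r \<in> S" "S \<inter> B = {}"
  shows "Pr_perc p G (\<lambda>\<omega>. \<exists>b\<in>B. conn \<omega> UNIV r b)
    \<le> (\<Sum>(x, y)\<in>bd_pairs G S. p * Pr_perc p G (\<lambda>\<omega>. conn \<omega> S r x)
          * Pr_perc p G (\<lambda>\<omega>. \<exists>b\<in>B. conn \<omega> UNIV y b))"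
proof -
  let ?R = "\<lambda>\<omega>. reach \<omega> S {r}"
  let ?P = "Pr_perc p G"
  have fin: "finite (bd_pairs G S)" "finite (Pow S)"
    using G S by (auto intro: bd_pairs_finite)
  have pw: "of_bool (\<exists>b\<in>B. conn \<omega> UNIV r b)
      \<le> (\<Sum>(x, y)\<in>bd_pairs G S. \<Sum>C\<in>Pow S. of_bool (x \<in> C) *
           ((of_bool (?R \<omega> = C) * of_bool ({x, y} \<in> \<omega>)) * of_bool (\<exists>b\<in>B. conn \<omega> (- C) y b) :: real))"
    (is "_ \<le> (\<Sum>(x, y)\<in>_. ?t x y)")
    if w: "\<omega> \<subseteq> G" for \<omega>
  proof (cases "\<exists>b\<in>B. conn \<omega> UNIV r b")
    case True
    then obtain b where b: "b \<in> B" "conn \<omega> UNIV r b" by auto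
    define C where "C = ?R \<omega>"
    have "C \<subseteq> S" "r \<in> C"
      using S by (auto simp: C_def reach_subset) (auto simp: reach_def intro: conn_refl)
    moreover have "b \<notin> C"
      using b S \<open>C \<subseteq> S\<close> by auto
    ultimately obtain x y where xy: "x \<in> C" "y \<notin> C" "{x, y} \<in> \<omega>" "conn \<omega> (UNIV - C) y b"
      using conn_last_exit[OF b(2)] by metis
    \<comment> \<open>otherwise the open edge \<open>{x, y}\<close> would put \<open>y\<close> into the cluster\<close>
    have "y \<notin> S"
      using xy by (auto simp: C_def reach_def intro: conn_step)
    then have bd: "(x, y) \<in> bd_pairs G S"
      using xy w \<open>C \<subseteq> S\<close> by (auto simp: bd_pairs_def)
    have "of_bool (\<exists>b\<in>B. conn \<omega> UNIV r b) = of_bool (x \<in> C) *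
           ((of_bool (?R \<omega> = C) * of_bool ({x, y} \<in> \<omega>)) * of_bool (\<exists>b\<in>B. conn \<omega> (- C) y b) :: real)"
      using True xy b(1) by (auto simp: C_def Compl_eq_Diff_UNIV)
    also have "\<dots> \<le> ?t x y"
      using fin \<open>C \<subseteq> S\<close> by (intro member_le_sum) auto
    also have "\<dots> = (\<lambda>(x, y). ?t x y) (x, y)"
      by simp
    also have "\<dots> \<le> (\<Sum>(x, y)\<in>bd_pairs G S. ?t x y)"
      using bd fin(1) by (intro member_le_sum) (auto intro!: sum_nonneg)
    finally show ?thesis .
  qed (auto intro!: sum_nonneg)
  have factor: "Ex_perc p G (\<lambda>\<omega>. of_bool (x \<in> C) *
       ((of_bool (?R \<omega> = C) * of_bool ({x, y} \<in> \<omega>)) * of_bool (\<exists>b\<in>B. conn \<omega> (- C) y b)))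
     \<le> of_bool (x \<in> C) * ?P (\<lambda>\<omega>. ?R \<omega> = C) * (p * ?P (\<lambda>\<omega>. \<exists>b\<in>B. conn \<omega> UNIV y b))"
    if xy: "(x, y) \<in> bd_pairs G S" and C: "C \<subseteq> S" for x y C
  proof (cases "x \<in> C")
    case True
    have xy': "{x, y} \<in> G" "y \<notin> S"
      using xy by (auto simp: bd_pairs_def)
    let ?E1 = "{e\<in>G. e \<subseteq> S \<and> e \<inter> C \<noteq> {}}" and ?E3 = "{e\<in>G. e \<subseteq> - C}"
    have l1: "(?R (\<omega> \<inter> ?E1) = C) = (?R \<omega> = C)" if "\<omega> \<subseteq> G" for \<omega>
      using reach_local[OF that] .
    have l3: "conn (\<omega> \<inter> ?E3) (- C) y b = conn \<omega> (- C) y b" if "\<omega> \<subseteq> G" for \<omega> b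
    proof -
      have "\<omega> \<inter> ?E3 = \<omega> \<inter> {e. e \<subseteq> - C}" using that by auto
      then show ?thesis by (simp add: conn_restrict_edges)
    qed
    have "Ex_perc p G (\<lambda>\<omega>. (of_bool (?R \<omega> = C) * of_bool ({x, y} \<in> \<omega>)) *
          of_bool (\<exists>b\<in>B. conn \<omega> (- C) y b))
        = Ex_perc p G (\<lambda>\<omega>. of_bool (?R \<omega> = C) * of_bool ({x, y} \<in> \<omega>))
          * ?P (\<lambda>\<omega>. \<exists>b\<in>B. conn \<omega> (- C) y b)"
    proof (rule Ex_perc_indep[where F = "insert {x, y} ?E1" and H = ?E3])
      fix \<omega> assume w: "\<omega> \<subseteq> G"
      have "\<omega> \<inter> insert {x, y} ?E1 \<inter> ?E1 = \<omega> \<inter> ?E1" by auto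
      then have "(?R (\<omega> \<inter> insert {x, y} ?E1) = C) = (?R \<omega> = C)"
        using l1[of "\<omega> \<inter> insert {x, y} ?E1"] l1[of \<omega>] w by auto
      then show "(of_bool (?R (\<omega> \<inter> insert {x, y} ?E1) = C) * of_bool ({x, y} \<in> \<omega> \<inter> insert {x, y} ?E1) :: real)
          = of_bool (?R \<omega> = C) * of_bool ({x, y} \<in> \<omega>)"
        by simp
    next
      show "insert {x, y} ?E1 \<inter> ?E3 = {}"
        using True by auto
    qed (use G xy' l3 in auto)
    also have "Ex_perc p G (\<lambda>\<omega>. of_bool (?R \<omega> = C) * of_bool ({x, y} \<in> \<omega>))
        = ?P (\<lambda>\<omega>. ?R \<omega> = C) * ?P (\<lambda>\<omega>. {x, y} \<in> \<omega>)"
    proof (rule Ex_perc_indep[where F = "?E1" and H = "{{x, y}}"])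
      show "?E1 \<inter> {{x, y}} = {}"
        using xy' by auto
    qed (use G xy' l1 in auto)
    also have "?P (\<lambda>\<omega>. {x, y} \<in> \<omega>) = p"
      using G xy' by (intro Pr_perc_edge_open)
    finally have eq: "Ex_perc p G (\<lambda>\<omega>. (of_bool (?R \<omega> = C) * of_bool ({x, y} \<in> \<omega>)) *
          of_bool (\<exists>b\<in>B. conn \<omega> (- C) y b))
        = ?P (\<lambda>\<omega>. ?R \<omega> = C) * p * ?P (\<lambda>\<omega>. \<exists>b\<in>B. conn \<omega> (- C) y b)" .
    have 0: "0 \<le> ?P (\<lambda>\<omega>. ?R \<omega> = C)"
      using p by (rule Pr_perc_nonneg)
    have "?P (\<lambda>\<omega>. \<exists>b\<in>B. conn \<omega> (- C) y b) \<le> ?P (\<lambda>\<omega>. \<exists>b\<in>B. conn \<omega> UNIV y b)"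
      using p by (intro Ex_perc_mono) (auto intro: conn_mono)
    then have "?P (\<lambda>\<omega>. ?R \<omega> = C) * p * ?P (\<lambda>\<omega>. \<exists>b\<in>B. conn \<omega> (- C) y b)
       \<le> ?P (\<lambda>\<omega>. ?R \<omega> = C) * p * ?P (\<lambda>\<omega>. \<exists>b\<in>B. conn \<omega> UNIV y b)"
      using 0 p by (intro mult_left_mono) auto
    moreover have "(of_bool (x \<in> C) :: real) = 1"
      using True by simp
    ultimately show ?thesis
      by (simp only: mult_1 eq)
  qed (use G in simp)
  have cl: "(\<Sum>C\<in>Pow S. of_bool (x \<in> C) * ?P (\<lambda>\<omega>. ?R \<omega> = C)) = ?P (\<lambda>\<omega>. conn \<omega> S r x)" for x
  proof -
    have "(\<Sum>C\<in>Pow S. of_bool (x \<in> C) * ?P (\<lambda>\<omega>. ?R \<omega> = C))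
        = Ex_perc p G (\<lambda>\<omega>. \<Sum>C\<in>Pow S. of_bool (x \<in> C) * of_bool (?R \<omega> = C))"
      by (simp add: Ex_perc_sum Ex_perc_cmult)
    also have "\<dots> = ?P (\<lambda>\<omega>. conn \<omega> S r x)"
    proof (rule Ex_perc_cong)
      fix \<omega>
      have "(\<Sum>C\<in>Pow S. of_bool (x \<in> C) * of_bool (?R \<omega> = C) :: real)
          = (\<Sum>C\<in>Pow S. if ?R \<omega> = C then of_bool (x \<in> C) else 0)"
        by (intro sum.cong) auto
      also have "\<dots> = of_bool (x \<in> ?R \<omega>)"
        using fin(2) reach_subset[of \<omega> S "{r}"] by simp
      finally show "(\<Sum>C\<in>Pow S. of_bool (x \<in> C) * of_bool (?R \<omega> = C) :: real) = of_bool (conn \<omega> S r x)"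
        by (simp add: reach_def)
    qed
    finally show ?thesis .
  qed
  have "?P (\<lambda>\<omega>. \<exists>b\<in>B. conn \<omega> UNIV r b)
      \<le> Ex_perc p G (\<lambda>\<omega>. \<Sum>(x, y)\<in>bd_pairs G S. \<Sum>C\<in>Pow S. of_bool (x \<in> C) *
           ((of_bool (?R \<omega> = C) * of_bool ({x, y} \<in> \<omega>)) * of_bool (\<exists>b\<in>B. conn \<omega> (- C) y b)))"
    using p pw by (intro Ex_perc_mono)
  also have "\<dots> = (\<Sum>(x, y)\<in>bd_pairs G S. \<Sum>C\<in>Pow S. Ex_perc p G (\<lambda>\<omega>. of_bool (x \<in> C) *
           ((of_bool (?R \<omega> = C) * of_bool ({x, y} \<in> \<omega>)) * of_bool (\<exists>b\<in>B. conn \<omega> (- C) y b))))"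
    by (simp add: case_prod_unfold Ex_perc_sum)
  also have "\<dots> \<le> (\<Sum>(x, y)\<in>bd_pairs G S. \<Sum>C\<in>Pow S.
       of_bool (x \<in> C) * ?P (\<lambda>\<omega>. ?R \<omega> = C) * (p * ?P (\<lambda>\<omega>. \<exists>b\<in>B. conn \<omega> UNIV y b)))"
    using factor by (auto intro!: sum_mono simp del: Ex_perc_const)
  also have "\<dots> = (\<Sum>(x, y)\<in>bd_pairs G S. p * ?P (\<lambda>\<omega>. conn \<omega> S r x)
          * ?P (\<lambda>\<omega>. \<exists>b\<in>B. conn \<omega> UNIV y b))"
    unfolding sum_distrib_right[symmetric] cl by (intro sum.cong) auto
  finally show ?thesis .
qed

text \<open>
  Let \<open>U\<close> be the set of vertices of \<open>V\<close> that are not connected to \<open>B\<close>. If \<open>r \<in> U\<close>, every edge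
  \<open>{x, y}\<close> leaving \<open>U\<close> whose inner endpoint \<open>x\<close> is connected to \<open>r\<close> in \<open>U\<close> is a closed pivotal edge
  for the event \<open>A\<close> that \<open>r\<close> is connected to \<open>B\<close>. For fixed \<open>S\<close>, the event \<open>U = S\<close> depends only on
  the edges that are not inside \<open>S\<close>, hence is independent of the connections in \<open>S\<close>. So the
  hypothesis \<open>phi\<close> makes \<open>p\<close> times the expected number of closed pivotal edges at least the
  probability that \<open>r \<in> U\<close>, which is the probability of the complement of \<open>A\<close>. By Russo's formula
  the sum of the influences is the derivative of the probability of \<open>A\<close>.
\<close>

lemma influence_inequality:
  assumes p: "0 \<le> p" "p \<le> 1" and G: "finite G" "\<And>e. e \<in> G \<Longrightarrow> e \<subseteq> V"
    and V: "finite V" "r \<in> V" "B \<subseteq> V"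
    and phi: "\<And>S. S \<subseteq> V - B \<Longrightarrow> r \<in> S \<Longrightarrow>
        1 \<le> p * (\<Sum>(x, y)\<in>bd_pairs G S. Pr_perc p G (\<lambda>\<omega>. conn \<omega> S r x))"
  defines "A \<equiv> (\<lambda>\<omega>. \<exists>b\<in>B. conn \<omega> V r b)"
  shows "1 - Pr_perc p G A \<le> p * (1 - p) * (\<Sum>e\<in>G. influence p G (\<lambda>\<omega>. of_bool (A \<omega>)) e)"
proof -
  let ?P = "Pr_perc p G"
  let ?U = "\<lambda>\<omega>. V - reach \<omega> V B"
  let ?SS = "{S. S \<subseteq> V - B \<and> r \<in> S}"
  have fin: "finite ?SS" "finite (bd_pairs G S)" for S
    using G V by (auto intro: bd_pairs_finite)
  have U: "?U \<omega> \<subseteq> V - B" "r \<in> ?U \<omega> \<longleftrightarrow> \<not> A \<omega>" for \<omega>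
  proof -
    have "b \<in> reach \<omega> V B" if "b \<in> B" for b
      using that V by (auto simp: reach_def intro: conn_refl)
    then show "?U \<omega> \<subseteq> V - B" by auto
    show "r \<in> ?U \<omega> \<longleftrightarrow> \<not> A \<omega>"
      using V by (auto simp: A_def reach_def intro: conn_sym)
  qed
  have pick: "(\<Sum>S\<in>?SS. of_bool (?U \<omega> = S) * h S) = of_bool (\<not> A \<omega>) * (h (?U \<omega>) :: real)" for \<omega> h
  proof -
    have "(\<Sum>S\<in>?SS. of_bool (?U \<omega> = S) * h S) = (\<Sum>S\<in>?SS. if ?U \<omega> = S then h S else 0)"
      by (intro sum.cong) auto
    also have "\<dots> = (if ?U \<omega> \<in> ?SS then h (?U \<omega>) else 0)"
      using fin(1) by (rule sum.delta')
    also have "?U \<omega> \<in> ?SS \<longleftrightarrow> \<not> A \<omega>"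
      using U by blast
    finally show ?thesis by simp
  qed
  have piv: "(\<Sum>(x, y)\<in>bd_pairs G (?U \<omega>). of_bool (conn \<omega> (?U \<omega>) r x))
      \<le> (\<Sum>e\<in>G. of_bool (\<not> A \<omega> \<and> A (insert e \<omega>)) :: real)" if "\<not> A \<omega>" for \<omega>
  proof -
    have inj: "inj_on (\<lambda>(x, y). {x, y}) (bd_pairs G S)" for S
      by (auto simp: inj_on_def bd_pairs_def doubleton_eq_iff)
    have *: "A (insert {x, y} \<omega>)" if xy: "(x, y) \<in> bd_pairs G (?U \<omega>)" and c: "conn \<omega> (?U \<omega>) r x" for x y
    proof -
      have y: "{x, y} \<in> G" "y \<notin> ?U \<omega>" using xy by (auto simp: bd_pairs_def)
      then have "y \<in> reach \<omega> V B" using G(2) by blast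
      then obtain b where b: "b \<in> B" "conn \<omega> V b y" by (auto simp: reach_def)
      have "conn (insert {x, y} \<omega>) V r x"
        using c by (rule conn_mono) auto
      then have "conn (insert {x, y} \<omega>) V r y"
        by (rule conn_step) (use y G(2) in auto)
      moreover have "conn (insert {x, y} \<omega>) V y b"
        using conn_sym[OF b(2)] by (rule conn_mono) auto
      ultimately show ?thesis
        using b(1) conn_trans by (fastforce simp: A_def)
    qed
    have "(\<Sum>(x, y)\<in>bd_pairs G (?U \<omega>). of_bool (conn \<omega> (?U \<omega>) r x))
        \<le> (\<Sum>(x, y)\<in>bd_pairs G (?U \<omega>). of_bool (\<not> A \<omega> \<and> A (insert {x, y} \<omega>)) :: real)"
      using * that by (intro sum_mono) auto
    also have "\<dots> = (\<Sum>e\<in>(\<lambda>(x, y). {x, y}) ` bd_pairs G (?U \<omega>). of_bool (\<not> A \<omega> \<and> A (insert e \<omega>)))"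
      by (subst sum.reindex[OF inj]) (simp add: case_prod_unfold)
    also have "\<dots> \<le> (\<Sum>e\<in>G. of_bool (\<not> A \<omega> \<and> A (insert e \<omega>)))"
      using G(1) by (intro sum_mono2) (auto simp: bd_pairs_def)
    finally show ?thesis .
  qed
  have ind: "Ex_perc p G (\<lambda>\<omega>. of_bool (?U \<omega> = S) * of_bool (conn \<omega> S r x))
      = ?P (\<lambda>\<omega>. ?U \<omega> = S) * ?P (\<lambda>\<omega>. conn \<omega> S r x)" if "S \<subseteq> V - B" for S x
  proof (rule Ex_perc_indep)
    let ?E = "{e\<in>G. e \<subseteq> V \<and> e \<inter> (V - S) \<noteq> {}}"
    show "?E \<inter> {e\<in>G. e \<subseteq> S} = {}" by auto
    fix \<omega> assume w: "\<omega> \<subseteq> G"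
    have "?U \<omega>' = S \<longleftrightarrow> reach \<omega>' V B = V - S" for \<omega>'
      using that reach_subset[of \<omega>' V B] by auto
    then show "(of_bool (?U (\<omega> \<inter> ?E) = S) :: real) = of_bool (?U \<omega> = S)"
      by (simp add: reach_local[OF w])
    have "\<omega> \<inter> {e\<in>G. e \<subseteq> S} = \<omega> \<inter> {e. e \<subseteq> S}" using w by auto
    then show "(of_bool (conn (\<omega> \<inter> {e\<in>G. e \<subseteq> S}) S r x) :: real) = of_bool (conn \<omega> S r x)"
      by (simp add: conn_restrict_edges)
  qed (use G in auto)
  have nonneg: "0 \<le> ?P Q" for Q
    using p by (rule Pr_perc_nonneg)
  have "1 - ?P A = Ex_perc p G (\<lambda>\<omega>. 1 - of_bool (A \<omega>))"
    using G by (simp add: Ex_perc_diff)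
  also have "\<dots> = Ex_perc p G (\<lambda>\<omega>. \<Sum>S\<in>?SS. of_bool (?U \<omega> = S) * 1)"
    unfolding pick by (rule Ex_perc_cong) simp
  also have "\<dots> = (\<Sum>S\<in>?SS. ?P (\<lambda>\<omega>. ?U \<omega> = S))"
    by (simp add: Ex_perc_sum)
  also have "\<dots> \<le> (\<Sum>S\<in>?SS. ?P (\<lambda>\<omega>. ?U \<omega> = S)
        * (p * (\<Sum>(x, y)\<in>bd_pairs G S. ?P (\<lambda>\<omega>. conn \<omega> S r x))))"
  proof (rule sum_mono)
    fix S assume "S \<in> ?SS"
    then show "?P (\<lambda>\<omega>. ?U \<omega> = S) \<le> ?P (\<lambda>\<omega>. ?U \<omega> = S)
        * (p * (\<Sum>(x, y)\<in>bd_pairs G S. ?P (\<lambda>\<omega>. conn \<omega> S r x)))"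
      using mult_left_mono[OF phi[of S] nonneg[of "\<lambda>\<omega>. ?U \<omega> = S"]] by simp
  qed
  also have "\<dots> = p * (\<Sum>S\<in>?SS. \<Sum>(x, y)\<in>bd_pairs G S. ?P (\<lambda>\<omega>. ?U \<omega> = S) * ?P (\<lambda>\<omega>. conn \<omega> S r x))"
    by (simp add: sum_distrib_left case_prod_unfold mult_ac)
  also have "(\<Sum>S\<in>?SS. \<Sum>(x, y)\<in>bd_pairs G S. ?P (\<lambda>\<omega>. ?U \<omega> = S) * ?P (\<lambda>\<omega>. conn \<omega> S r x))
     = (\<Sum>S\<in>?SS. \<Sum>(x, y)\<in>bd_pairs G S. Ex_perc p G (\<lambda>\<omega>. of_bool (?U \<omega> = S) * of_bool (conn \<omega> S r x)))"
    by (intro sum.cong refl) (auto simp: ind)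
  also have "\<dots> = Ex_perc p G (\<lambda>\<omega>. \<Sum>S\<in>?SS. of_bool (?U \<omega> = S)
        * (\<Sum>(x, y)\<in>bd_pairs G S. of_bool (conn \<omega> S r x)))"
    by (simp add: Ex_perc_sum sum_distrib_left case_prod_unfold)
  also have "\<dots> \<le> Ex_perc p G (\<lambda>\<omega>. \<Sum>e\<in>G. of_bool (\<not> A \<omega> \<and> A (insert e \<omega>)))"
    unfolding pick using p piv by (intro Ex_perc_mono) auto
  also have "\<dots> = (\<Sum>e\<in>G. ?P (\<lambda>\<omega>. \<not> A \<omega> \<and> A (insert e \<omega>)))"
    by (rule Ex_perc_sum)
  also have "\<dots> = (\<Sum>e\<in>G. (1 - p) * influence p G (\<lambda>\<omega>. of_bool (A \<omega>)) e)"
    by (intro sum.cong refl influence_closed_pivotal[symmetric] G)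
      (auto simp: A_def intro: conn_mono)
  finally show ?thesis
    using p(1) by (simp add: sum_distrib_left[symmetric] mult_left_mono mult.assoc)
qed

section \<open>Boxes in the lattice\<close>

lemma lattice_edges_iff: "{x, y} \<in> lattice_edges \<longleftrightarrow> dist (embed x) (embed y) = 1"
  by (auto simp: lattice_edges_def doubleton_eq_iff dist_commute)

lemma lattice_edge_coordinate:
  assumes "{x, y} \<in> lattice_edges"
  shows "\<bar>y $ i - x $ i\<bar> \<le> 1"
proof -
  have "norm (embed y - embed x) = 1"
    using assms by (simp add: lattice_edges_iff dist_norm norm_minus_commute)
  then have "\<bar>(embed y - embed x) $ i\<bar> \<le> 1"
    using component_le_norm_cart[of "embed y - embed x" i] by simp
  then show ?thesis
    by (simp add: embed_def flip: of_int_diff)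
qed

lemma lattice_edges_translate:
  fixes a :: "int ^ 'd::finite"
  assumes "e \<in> lattice_edges"
  shows "(\<lambda>v. v + a) ` e \<in> lattice_edges"
proof -
  obtain x y where e: "e = {x, y}" "dist (embed x) (embed y) = 1"
    using assms by (auto simp: lattice_edges_def)
  have "embed (x + a) = embed x + embed a" "embed (y + a) = embed y + embed a"
    by (simp_all add: embed_def vec_eq_iff)
  then have "{x + a, y + a} \<in> lattice_edges"
    using e by (simp add: lattice_edges_iff)
  then show ?thesis by (simp add: e)
qed

lemma finite_lattice_box: "finite (lattice_box n :: (int ^ 'd::finite) set)"
proof (rule finite_subset)
  show "(lattice_box n :: (int ^ 'd) set) \<subseteq> vec_lambda ` (PiE UNIV (\<lambda>_. {- int n..int n}))"
  proof
    fix x :: "int ^ 'd" assume "x \<in> lattice_box n"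
    then show "x \<in> vec_lambda ` (PiE UNIV (\<lambda>_. {- int n..int n}))"
      by (intro image_eqI[of _ _ "vec_nth x"]) (auto simp: lattice_box_def)
  qed
  show "finite (vec_lambda ` (PiE UNIV (\<lambda>_. {- int n..int n})) :: (int ^ 'd) set)"
    by (intro finite_imageI finite_PiE) auto
qed

lemma lattice_box_mono:
  assumes "m \<le> n"
  shows "lattice_box m \<subseteq> (lattice_box n :: (int ^ 'd::finite) set)"
proof
  fix x :: "int ^ 'd" assume "x \<in> lattice_box m"
  then have "- int m \<le> x $ i \<and> x $ i \<le> int m" for i
    by (simp add: lattice_box_def)
  then have "- int n \<le> x $ i \<and> x $ i \<le> int n" for i
    using assms by (smt (verit) of_nat_mono)
  then show "x \<in> lattice_box n"
    by (simp add: lattice_box_def)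
qed

lemma zero_in_lattice_box: "0 \<in> lattice_box n"
  by (simp add: lattice_box_def)

lemma lattice_box_add:
  assumes "x \<in> lattice_box m" "y \<in> lattice_box n"
  shows "x + y \<in> lattice_box (m + n)"
proof -
  have "- int m \<le> x $ i" "x $ i \<le> int m" "- int n \<le> y $ i" "y $ i \<le> int n" for i
    using assms by (auto simp: lattice_box_def)
  then have "- int (m + n) \<le> x $ i + y $ i \<and> x $ i + y $ i \<le> int (m + n)" for i
    by (smt (verit) of_nat_add)
  then show ?thesis
    by (simp add: lattice_box_def)
qed

lemma lattice_box_step:
  assumes "x \<in> lattice_box n" "{x, y} \<in> lattice_edges"
  shows "y \<in> lattice_box (Suc n)"
proof -
  have "- 1 \<le> y $ i - x $ i \<and> y $ i - x $ i \<le> 1" for i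
    using lattice_edge_coordinate[OF assms(2), of i] by linarith
  then have "y - x \<in> lattice_box 1"
    by (simp add: lattice_box_def)
  then show ?thesis
    using lattice_box_add[OF assms(1), of "y - x" 1] by simp
qed

lemma finite_subset_lattice_box:
  fixes S :: "(int ^ 'd::finite) set"
  assumes "finite S"
  obtains k where "S \<subseteq> lattice_box k"
proof -
  have "\<exists>k. x \<in> lattice_box k" for x :: "int ^ 'd"
  proof -
    have "x \<in> lattice_box (nat (\<Sum>i\<in>UNIV. \<bar>x $ i\<bar>))"
    proof -
      have "\<bar>x $ i\<bar> \<le> (\<Sum>i\<in>UNIV. \<bar>x $ i\<bar>)" for i
        by (intro member_le_sum) auto
      then show ?thesis
        by (simp add: lattice_box_def sum_nonneg abs_le_iff minus_le_iff)
    qed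
    then show ?thesis by blast
  qed
  then obtain f where f: "\<And>x :: int ^ 'd. x \<in> lattice_box (f x)" by metis
  have "x \<in> lattice_box (\<Sum>x\<in>S. f x)" if "x \<in> S" for x
    using f[of x] lattice_box_mono[OF member_le_sum[of x S f]] assms that by auto
  then show ?thesis using that by blast
qed

text \<open>
  The lattice edges with both endpoints in the box of radius \<open>n\<close>.
\<close>

definition box_edges :: "nat \<Rightarrow> (int ^ 'd::finite) set set" where
  "box_edges n = {e \<in> lattice_edges. e \<subseteq> lattice_box n}"

lemma finite_box_edges: "finite (box_edges n)"
  by (rule finite_subset[of _ "Pow (lattice_box n)"]) (auto simp: box_edges_def finite_lattice_box)

lemma box_edges_mono: "m \<le> n \<Longrightarrow> box_edges m \<subseteq> box_edges n"
  using lattice_box_mono by (force simp: box_edges_def)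

text \<open>
  The origin is connected to a vertex outside the box of radius \<open>m\<close>. Since a lattice path leaving
  this box has to visit the boundary of the box of radius \<open>m + 1\<close>, this is the same as being
  connected to that boundary. The shift by one avoids the degenerate boundary of the box of radius \<open>0\<close>.
\<close>

definition leaves_box :: "nat \<Rightarrow> (int ^ 'd::finite) set set \<Rightarrow> bool" where
  "leaves_box m \<omega> \<longleftrightarrow> (\<exists>x\<in>- lattice_box m. conn \<omega> UNIV 0 x)"

lemma leaves_box_iff:
  assumes "\<omega> \<subseteq> lattice_edges"
  shows "leaves_box m \<omega> \<longleftrightarrow> (\<exists>b\<in>box_boundary (Suc m). conn \<omega> (lattice_box (Suc m)) 0 b)"
proof
  have *: "conn \<omega> (lattice_box (Suc m)) 0 x \<or> (\<exists>b\<in>box_boundary (Suc m). conn \<omega> (lattice_box (Suc m)) 0 b)"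
    if "conn \<omega> UNIV 0 x" for x
    using that
  proof (induction rule: conn.induct)
    case conn_refl
    then show ?case using zero_in_lattice_box by (auto intro: conn.conn_refl)
  next
    case (conn_step y z)
    show ?case
    proof (cases "conn \<omega> (lattice_box (Suc m)) 0 y \<and> y \<in> lattice_box m")
      case True
      then have "z \<in> lattice_box (Suc m)"
        using conn_step.hyps assms lattice_box_step by blast
      then show ?thesis
        using True conn_step.hyps by (auto intro: conn.conn_step)
    next
      case False
      then show ?thesis
        using conn_step.IH conn_in by (fastforce simp: box_boundary_def)
    qed
  qed
  assume "leaves_box m \<omega>"
  then obtain x where x: "x \<notin> lattice_box m" "conn \<omega> UNIV 0 x"
    by (auto simp: leaves_box_def)
  then show "\<exists>b\<in>box_boundary (Suc m). conn \<omega> (lattice_box (Suc m)) 0 b"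
    using *[of x] by (auto simp: box_boundary_def dest: conn_in)
next
  assume "\<exists>b\<in>box_boundary (Suc m). conn \<omega> (lattice_box (Suc m)) 0 b"
  then show "leaves_box m \<omega>"
    by (auto simp: leaves_box_def box_boundary_def intro: conn_mono)
qed

lemma conn_local:
  assumes "\<omega> \<subseteq> lattice_edges" "S \<subseteq> lattice_box n" "box_edges n \<subseteq> G"
  shows "conn (\<omega> \<inter> G) S x y \<longleftrightarrow> conn \<omega> S x y"
proof -
  have "(\<omega> \<inter> G) \<inter> {e. e \<subseteq> S} = \<omega> \<inter> {e. e \<subseteq> S}"
    using assms unfolding box_edges_def by blast
  then show ?thesis
    by (metis conn_restrict_edges)
qed

lemma leaves_box_local:
  assumes "\<omega> \<subseteq> lattice_edges" "box_edges (Suc m) \<subseteq> G"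
  shows "leaves_box m (\<omega> \<inter> G) \<longleftrightarrow> leaves_box m \<omega>"
proof -
  have "\<omega> \<inter> G \<subseteq> lattice_edges"
    using assms by auto
  then show ?thesis
    using assms by (simp add: leaves_box_iff conn_local[OF _ subset_refl])
qed

text \<open>
  The probability of \<open>leaves_box m\<close>. By \<open>leaves_box_local\<close> only the edges of the box of radius
  \<open>m + 1\<close> matter, so this is a polynomial in \<open>p\<close>.
\<close>

definition leave_prob :: "'d::finite itself \<Rightarrow> nat \<Rightarrow> real \<Rightarrow> real" where
  "leave_prob _ m p = Pr_perc p (box_edges (Suc m) :: (int ^ 'd) set set) (leaves_box m)"

lemma leave_prob_eq:
  fixes G :: "(int ^ 'd::finite) set set"
  assumes "finite G" "G \<subseteq> lattice_edges" "box_edges (Suc m) \<subseteq> G"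
  shows "Pr_perc p G (leaves_box m) = leave_prob TYPE('d) m p"
  unfolding leave_prob_def
proof (rule Ex_perc_marginal)
  fix \<omega> assume "\<omega> \<subseteq> G"
  then have "\<omega> \<subseteq> lattice_edges"
    using assms(2) by blast
  then show "(of_bool (leaves_box m (\<omega> \<inter> box_edges (Suc m))) :: real) = of_bool (leaves_box m \<omega>)"
    by (simp add: leaves_box_local)
qed (use assms in auto)

section \<open>From the infinite product measure to finite edge sets\<close>

text \<open>
  The open edges of a configuration. Restricting to lattice edges is essential, since the value of
  \<open>\<omega>\<close> elsewhere carries no information.
\<close>

definition open_edges :: "'d::finite configuration \<Rightarrow> (int ^ 'd) set set" where
  "open_edges \<omega> = {e \<in> lattice_edges. \<omega> e}"

lemma open_edges_subset: "open_edges \<omega> \<subseteq> lattice_edges"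
  by (auto simp: open_edges_def)

lemma connected_in_iff: "connected_in \<omega> S x y \<longleftrightarrow> conn (open_edges \<omega>) S x y"
proof
  assume "connected_in \<omega> S x y"
  then obtain K v where v: "\<And>k. k \<le> K \<Longrightarrow> v k \<in> S" "v 0 = x" "v K = y"
    "\<And>k. k < K \<Longrightarrow> {v k, v (Suc k)} \<in> open_edges \<omega>"
    unfolding connected_in_def open_edges_def by blast
  have "k \<le> K \<Longrightarrow> conn (open_edges \<omega>) S x (v k)" for k
  proof (induction k)
    case 0
    have "x \<in> S"
      using v(1)[of 0] v(2) by simp
    then show ?case
      unfolding v(2) by (rule conn.conn_refl)
  next
    case (Suc k)
    then show ?case
      using v(1)[of "Suc k"] v(4)[of k] by (auto intro: conn.conn_step)
  qed
  then show "conn (open_edges \<omega>) S x y"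
    using v(3) by blast
next
  assume "conn (open_edges \<omega>) S x y"
  then show "connected_in \<omega> S x y"
  proof (induction rule: conn.induct)
    case conn_refl
    then show ?case
      unfolding connected_in_def by (intro exI[of _ 0] exI[of _ "\<lambda>_. x"]) auto
  next
    case (conn_step y z)
    then obtain K v where v: "\<forall>k\<le>K. v k \<in> S" "v 0 = x" "v K = y"
      "\<forall>k<K. {v k, v (Suc k)} \<in> lattice_edges \<and> \<omega> {v k, v (Suc k)}"
      unfolding connected_in_def by blast
    define v' where "v' = (\<lambda>k. if k \<le> K then v k else z)"
    have "{v' k, v' (Suc k)} \<in> lattice_edges \<and> \<omega> {v' k, v' (Suc k)}" if "k < Suc K" for k
      using that v conn_step.hyps by (cases "k = K") (auto simp: v'_def open_edges_def)
    moreover have "\<forall>k\<le>Suc K. v' k \<in> S" "v' 0 = x" "v' (Suc K) = z"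
      using v conn_step.hyps by (auto simp: v'_def)
    ultimately show ?case
      unfolding connected_in_def by blast
  qed
qed

lemma connected_to_boundary_iff:
  "connected_to_boundary (Suc m) \<omega> \<longleftrightarrow> leaves_box m (open_edges \<omega>)"
proof
  assume "leaves_box m (open_edges \<omega>)"
  then show "connected_to_boundary (Suc m) \<omega>"
    unfolding leaves_box_iff[OF open_edges_subset] connected_to_boundary_def connected_in_iff
    by (auto intro: conn_mono)
qed (auto simp: connected_to_boundary_def connected_in_iff leaves_box_def box_boundary_def)

lemma connected_to_infinity_iff:
  "connected_to_infinity \<omega> \<longleftrightarrow> (\<forall>m. leaves_box m (open_edges \<omega>))"
proof
  let ?C = "{x. conn (open_edges \<omega>) UNIV 0 x}"
  {
    assume "connected_to_infinity \<omega>"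
    then have inf: "infinite ?C"
      by (simp add: connected_to_infinity_def connected_in_iff)
    show "\<forall>m. leaves_box m (open_edges \<omega>)"
    proof
      fix m
      have "\<not> ?C \<subseteq> lattice_box m"
        using inf finite_lattice_box finite_subset by blast
      then show "leaves_box m (open_edges \<omega>)"
        by (auto simp: leaves_box_def)
    qed
  }
  assume *: "\<forall>m. leaves_box m (open_edges \<omega>)"
  have "infinite ?C"
  proof
    assume "finite ?C"
    then obtain k where "?C \<subseteq> lattice_box k"
      by (rule finite_subset_lattice_box)
    then show False
      using * by (auto simp: leaves_box_def)
  qed
  then show "connected_to_infinity \<omega>"
    by (simp add: connected_to_infinity_def connected_in_iff)
qed

lemma leaves_box_antimono: "m \<le> n \<Longrightarrow> leaves_box n \<omega> \<Longrightarrow> leaves_box m \<omega>"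
  using lattice_box_mono by (force simp: leaves_box_def)

lemma prob_space_percolation: "prob_space (percolation p)"
  unfolding percolation_def by (intro prob_space_PiM) (rule prob_space_measure_pmf)

text \<open>
  The bridge between the two models: an event that depends only on a finite set \<open>G\<close> of edges is a
  finite disjoint union of cylinders, and its probability is the one computed in \<open>G\<close>.
\<close>

lemma percolation_finite_range:
  fixes G :: "(int ^ 'd::finite) set set"
  assumes p: "0 \<le> p" "p \<le> 1" and G: "finite G" "G \<subseteq> lattice_edges"
    and loc: "\<And>\<omega>. \<omega> \<subseteq> lattice_edges \<Longrightarrow> A (\<omega> \<inter> G) = A \<omega>"
  shows "{\<omega> \<in> space (percolation p). A (open_edges \<omega>)} \<in> sets (percolation p)" (is "?A \<in> _")
    and "percolation_prob p (\<lambda>\<omega>. A (open_edges \<omega>)) = Pr_perc p G A"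
proof -
  let ?M = "percolation p :: 'd configuration measure"
  let ?B = "\<lambda>_ :: (int ^ 'd) set. measure_pmf (bernoulli_pmf p)"
  interpret P: product_prob_space ?B lattice_edges
    by unfold_locales
  interpret M: prob_space ?M by (rule prob_space_percolation)
  define Cyl where "Cyl \<eta> = prod_emb lattice_edges ?B G (\<Pi>\<^sub>E e\<in>G. {e \<in> \<eta>})" for \<eta>
  have Cyl: "\<omega> \<in> Cyl \<eta> \<longleftrightarrow> \<omega> \<in> space ?M \<and> open_edges \<omega> \<inter> G = \<eta>" if "\<eta> \<subseteq> G" for \<eta> \<omega>
    using that G(2)
    by (auto simp: Cyl_def prod_emb_iff percolation_def space_PiM PiE_iff open_edges_def)
  have sets: "Cyl \<eta> \<in> sets ?M" for \<eta>
    unfolding Cyl_def percolation_def using G by (intro sets_PiM_I) auto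
  have meas: "measure ?M (Cyl \<eta>) = (\<Prod>e\<in>G. if e \<in> \<eta> then p else 1 - p)" for \<eta>
    unfolding Cyl_def percolation_def using p G
    by (subst P.measure_PiM_emb) (auto simp: measure_pmf_single intro!: prod.cong)
  let ?I = "{\<eta>\<in>Pow G. A \<eta>}"
  have union: "?A = (\<Union>\<eta>\<in>?I. Cyl \<eta>)"
    using loc[OF open_edges_subset] Cyl by fastforce
  have fin: "finite ?I" using G by simp
  show "?A \<in> sets ?M"
    unfolding union using fin sets by (intro sets.finite_UN) auto
  have "disjoint_family_on Cyl ?I"
    using Cyl by (auto simp: disjoint_family_on_def)
  then have "measure ?M ?A = (\<Sum>\<eta>\<in>?I. measure ?M (Cyl \<eta>))"
    unfolding union using fin sets by (intro M.finite_measure_finite_Union) auto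
  also have "\<dots> = Pr_perc p G A"
    unfolding Ex_perc_def meas using G(1) by (intro sum.mono_neutral_cong_left) auto
  finally show "percolation_prob p (\<lambda>\<omega>. A (open_edges \<omega>)) = Pr_perc p G A"
    unfolding percolation_prob_def .
qed

lemma connected_to_boundary_prob:
  assumes "0 \<le> p" "p \<le> 1"
  shows "percolation_prob p (connected_to_boundary (Suc m) :: 'd::finite configuration \<Rightarrow> bool)
    = leave_prob TYPE('d) m p"
proof -
  have "percolation_prob p (\<lambda>\<omega> :: 'd configuration. leaves_box m (open_edges \<omega>)) = leave_prob TYPE('d) m p"
    unfolding leave_prob_def
    by (rule percolation_finite_range) (use assms finite_box_edges in \<open>auto simp: leaves_box_local box_edges_def\<close>)
  then show ?thesis
    unfolding connected_to_boundary_iff[abs_def] .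
qed

lemma leave_prob_tendsto:
  assumes p: "0 \<le> p" "p \<le> 1"
  shows "(\<lambda>m. leave_prob TYPE('d::finite) m p) \<longlonglongrightarrow> percolation_prob p (connected_to_infinity :: 'd configuration \<Rightarrow> bool)"
proof -
  let ?M = "percolation p :: 'd configuration measure"
  interpret M: prob_space ?M by (rule prob_space_percolation)
  let ?A = "\<lambda>m. {\<omega> \<in> space ?M. leaves_box m (open_edges \<omega>)}"
  have "?A m \<in> sets ?M" for m
    by (rule percolation_finite_range(1)[OF p finite_box_edges[of "Suc m"]])
      (auto simp: leaves_box_local box_edges_def)
  then have "range ?A \<subseteq> sets ?M"
    by blast
  moreover have "decseq ?A"
    by (auto simp: decseq_def intro: leaves_box_antimono)
  ultimately have "(\<lambda>m. measure ?M (?A m)) \<longlonglongrightarrow> measure ?M (\<Inter>m. ?A m)"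
    by (rule M.finite_Lim_measure_decseq)
  moreover have "(\<Inter>m. ?A m) = {\<omega> \<in> space ?M. connected_to_infinity \<omega>}"
    by (auto simp: connected_to_infinity_iff)
  moreover have "measure ?M (?A m) = leave_prob TYPE('d) m p" for m
    using connected_to_boundary_prob[OF p, of m, where 'd = 'd]
    by (simp add: percolation_prob_def connected_to_boundary_iff)
  ultimately show ?thesis
    by (simp add: percolation_prob_def)
qed

section \<open>Exponential decay\<close>

lemma bd_pairs_box_edges:
  assumes "S \<subseteq> lattice_box k" "k < n"
  shows "bd_pairs (box_edges n) S = bd_pairs lattice_edges S"
proof -
  have "{x, y} \<subseteq> lattice_box n" if "x \<in> S" "{x, y} \<in> lattice_edges" for x y
    using that assms lattice_box_step[of x k y] lattice_box_mono[of k n] lattice_box_mono[of "Suc k" n]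
    by auto
  then show ?thesis
    by (auto simp: bd_pairs_def box_edges_def)
qed

text \<open>
  \<open>phi p S\<close> in terms of oriented boundary edges, computed in any box larger than one that
  contains \<open>S\<close>.
\<close>

lemma phi_eq:
  fixes S :: "(int ^ 'd::finite) set"
  assumes p: "0 \<le> p" "p \<le> 1" and S: "S \<subseteq> lattice_box k" "k < n"
  shows "phi p S = p * (\<Sum>(x, y)\<in>bd_pairs (box_edges n) S. Pr_perc p (box_edges n) (\<lambda>\<omega>. conn \<omega> S 0 x))"
proof -
  let ?B = "bd_pairs lattice_edges S"
  have prob: "percolation_prob p (\<lambda>\<omega>. connected_in \<omega> S 0 x) = Pr_perc p (box_edges n) (\<lambda>\<omega>. conn \<omega> S 0 x)"
    for x
    unfolding connected_in_iff
  proof (rule percolation_finite_range(2)[OF p finite_box_edges])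
    fix \<omega> :: "(int ^ 'd) set set" assume "\<omega> \<subseteq> lattice_edges"
    moreover have "S \<subseteq> lattice_box n"
      using S lattice_box_mono[of k n] by auto
    ultimately show "conn (\<omega> \<inter> box_edges n) S 0 x = conn \<omega> S 0 x"
      by (rule conn_local) simp
  qed (auto simp: box_edges_def)
  have inj: "inj_on (\<lambda>(x, y). {x, y}) ?B"
    by (auto simp: inj_on_def bd_pairs_def doubleton_eq_iff)
  have img: "edge_boundary S = (\<lambda>(x, y). {x, y}) ` ?B"
    by (auto simp: edge_boundary_def bd_pairs_def)
  have the: "(THE z. (z = x \<or> z = y) \<and> z \<in> S) = x" if "(x, y) \<in> ?B" for x y
    using that by (auto simp: bd_pairs_def)
  have "phi p S = p * (\<Sum>(x, y)\<in>?B. Pr_perc p (box_edges n) (\<lambda>\<omega>. conn \<omega> S 0 x))"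
    unfolding phi_def img prob by (subst sum.reindex[OF inj]) (auto simp: the case_prod_unfold intro!: sum.cong)
  then show ?thesis
    by (simp add: bd_pairs_box_edges[OF S])
qed

text \<open>
  A path from \<open>y\<close> to the outside of the box of radius \<open>m + l\<close>, translated by \<open>- y\<close>, leads from the
  origin to the outside of the box of radius \<open>m\<close>.
\<close>

lemma translated_leave_prob:
  fixes y :: "int ^ 'd::finite"
  assumes p: "0 \<le> p" "p \<le> 1" and y: "y \<in> lattice_box l"
  shows "Pr_perc p (box_edges (Suc (m + l))) (\<lambda>\<omega>. \<exists>b\<in>- lattice_box (m + l). conn \<omega> UNIV y b)
    \<le> leave_prob TYPE('d) m p"
proof -
  let ?G = "box_edges (Suc (m + l)) :: (int ^ 'd) set set"
  let ?t = "\<lambda>v. v + (- y)"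
  have "Pr_perc p ?G (\<lambda>\<omega>. \<exists>b\<in>- lattice_box (m + l). conn \<omega> UNIV y b)
      \<le> Ex_perc p ?G (\<lambda>\<omega>. of_bool (leaves_box m ((`) ?t ` \<omega>)))"
  proof (rule Ex_perc_mono[OF p])
    fix \<omega>
    have "leaves_box m ((`) ?t ` \<omega>)" if "b \<notin> lattice_box (m + l)" "conn \<omega> UNIV y b" for b
    proof -
      have "conn ((`) ?t ` \<omega>) (?t ` UNIV) (?t y) (?t b)"
        using that(2) by (rule conn_image)
      then have "conn ((`) ?t ` \<omega>) UNIV 0 (?t b)"
        by (auto intro: conn_mono)
      moreover have "?t b \<notin> lattice_box m"
        using lattice_box_add[of "?t b" m y l] y that(1) by auto
      ultimately show ?thesis
        by (auto simp: leaves_box_def)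
    qed
    then show "(of_bool (\<exists>b\<in>- lattice_box (m + l). conn \<omega> UNIV y b) :: real)
        \<le> of_bool (leaves_box m ((`) ?t ` \<omega>))"
      by auto
  qed
  also have "\<dots> = Pr_perc p ((`) ?t ` ?G) (leaves_box m)"
    by (subst Ex_perc_image) (auto simp: finite_box_edges inj_image_eq_iff intro!: inj_onI)
  also have "\<dots> = leave_prob TYPE('d) m p"
  proof (rule leave_prob_eq)
    show "(`) ?t ` ?G \<subseteq> lattice_edges"
      using lattice_edges_translate[of _ "- y"] by (auto simp: box_edges_def)
    show "box_edges (Suc m) \<subseteq> (`) ?t ` ?G"
    proof
      fix e :: "(int ^ 'd) set" assume e: "e \<in> box_edges (Suc m)"
      have "(\<lambda>v. v + y) ` e \<in> ?G"
        using e lattice_edges_translate[of e y] lattice_box_add[of _ "Suc m" y l] y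
        by (auto simp: box_edges_def)
      moreover have "?t ` (\<lambda>v. v + y) ` e = e"
        by (simp add: image_image)
      ultimately show "e \<in> (`) ?t ` ?G"
        by (metis image_eqI)
    qed
  qed (simp add: finite_box_edges)
  finally show ?thesis .
qed

lemma leave_prob_bounds:
  assumes "0 \<le> p" "p \<le> 1"
  shows "0 \<le> leave_prob TYPE('d::finite) m p" "leave_prob TYPE('d) m p \<le> 1"
proof -
  let ?G = "box_edges (Suc m) :: (int ^ 'd) set set"
  have "Pr_perc p ?G (leaves_box m) \<le> Ex_perc p ?G (\<lambda>_. 1)"
    using assms by (intro Ex_perc_mono) auto
  then show "leave_prob TYPE('d) m p \<le> 1"
    by (simp add: leave_prob_def finite_box_edges)
qed (use assms in \<open>auto simp: leave_prob_def intro: Pr_perc_nonneg\<close>)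

lemma leave_prob_recursion:
  fixes S :: "(int ^ 'd::finite) set"
  assumes p: "0 \<le> p" "p \<le> 1" and S: "S \<subseteq> lattice_box k" "0 \<in> S"
  shows "leave_prob TYPE('d) (m + Suc k) p \<le> phi p S * leave_prob TYPE('d) m p"
proof -
  let ?G = "box_edges (Suc (m + Suc k)) :: (int ^ 'd) set set"
  let ?B = "- lattice_box (m + Suc k)"
  have "leave_prob TYPE('d) (m + Suc k) p = Pr_perc p ?G (\<lambda>\<omega>. \<exists>b\<in>?B. conn \<omega> UNIV 0 b)"
    by (simp add: leave_prob_def leaves_box_def)
  also have "\<dots> \<le> (\<Sum>(x, y)\<in>bd_pairs ?G S. p * Pr_perc p ?G (\<lambda>\<omega>. conn \<omega> S 0 x)
          * Pr_perc p ?G (\<lambda>\<omega>. \<exists>b\<in>?B. conn \<omega> UNIV y b))"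
    using p S lattice_box_mono[of k "m + Suc k"]
    by (intro exit_inequality) (auto simp: finite_box_edges intro: finite_subset[OF _ finite_lattice_box])
  also have "\<dots> \<le> (\<Sum>(x, y)\<in>bd_pairs ?G S. p * Pr_perc p ?G (\<lambda>\<omega>. conn \<omega> S 0 x)
          * leave_prob TYPE('d) m p)"
  proof (intro sum_mono, clarify)
    fix x y assume "(x, y) \<in> bd_pairs ?G S"
    then have "y \<in> lattice_box (Suc k)"
      using S lattice_box_step[of x k y] by (auto simp: bd_pairs_def box_edges_def)
    moreover have "0 \<le> Pr_perc p ?G (\<lambda>\<omega>. conn \<omega> S 0 x)"
      using p by (rule Pr_perc_nonneg)
    ultimately show "p * Pr_perc p ?G (\<lambda>\<omega>. conn \<omega> S 0 x) * Pr_perc p ?G (\<lambda>\<omega>. \<exists>b\<in>?B. conn \<omega> UNIV y b)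
        \<le> p * Pr_perc p ?G (\<lambda>\<omega>. conn \<omega> S 0 x) * leave_prob TYPE('d) m p"
      using p by (intro mult_left_mono translated_leave_prob) auto
  qed
  also have "\<dots> = phi p S * leave_prob TYPE('d) m p"
    using phi_eq[OF p S(1), of "Suc (m + Suc k)"]
    by (simp add: sum_distrib_left sum_distrib_right case_prod_unfold)
  finally show ?thesis .
qed

lemma phi_mono:
  assumes "0 \<le> p" "p \<le> q" "q \<le> 1" "finite S"
  shows "phi p S \<le> phi q S"
proof -
  obtain k where k: "S \<subseteq> lattice_box k"
    using finite_subset_lattice_box[OF assms(4)] .
  let ?G = "box_edges (Suc k)"
  have nonneg: "0 \<le> Pr_perc p ?G (\<lambda>\<omega>. conn \<omega> S 0 x)" for x
    using assms by (intro Pr_perc_nonneg) auto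
  have "Pr_perc p ?G (\<lambda>\<omega>. conn \<omega> S 0 x) \<le> Pr_perc q ?G (\<lambda>\<omega>. conn \<omega> S 0 x)" for x
    using assms by (intro Ex_perc_mono_param) (auto simp: finite_box_edges intro!: mono_onI intro: conn_mono)
  then have "(\<Sum>(x, y)\<in>bd_pairs ?G S. Pr_perc p ?G (\<lambda>\<omega>. conn \<omega> S 0 x))
      \<le> (\<Sum>(x, y)\<in>bd_pairs ?G S. Pr_perc q ?G (\<lambda>\<omega>. conn \<omega> S 0 x))"
    by (intro sum_mono) auto
  then show ?thesis
    using assms nonneg by (auto simp: phi_eq[OF _ _ k lessI] intro!: mult_mono sum_nonneg)
qed

lemma leave_prob_antimono:
  assumes "0 \<le> p" "p \<le> 1" "m \<le> n"
  shows "leave_prob TYPE('d::finite) n p \<le> leave_prob TYPE('d) m p"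
proof -
  let ?G = "box_edges (Suc n) :: (int ^ 'd) set set"
  have "leave_prob TYPE('d) n p \<le> Pr_perc p ?G (leaves_box m)"
    unfolding leave_prob_def using assms by (intro Ex_perc_mono) (auto intro: leaves_box_antimono)
  also have "\<dots> = leave_prob TYPE('d) m p"
    using assms(3) by (intro leave_prob_eq finite_box_edges box_edges_mono) (auto simp: box_edges_def)
  finally show ?thesis .
qed

lemma leave_prob_less_1:
  assumes "0 \<le> p" "p < 1"
  shows "leave_prob TYPE('d::finite) m p < 1"
proof -
  let ?G = "box_edges (Suc m) :: (int ^ 'd) set set"
  have "leaves_box m \<omega> \<Longrightarrow> \<omega> \<noteq> {}" for \<omega> :: "(int ^ 'd) set set"
  proof -
    have "conn {} UNIV 0 x \<Longrightarrow> x = 0" for x :: "int ^ 'd"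
      by (induction rule: conn.induct) auto
    then show "leaves_box m \<omega> \<Longrightarrow> \<omega> \<noteq> {}"
      using zero_in_lattice_box by (auto simp: leaves_box_def)
  qed
  then have "leave_prob TYPE('d) m p \<le> Ex_perc p ?G (\<lambda>\<omega>. 1 - of_bool (\<omega> = {}))"
    unfolding leave_prob_def using assms by (intro Ex_perc_mono) auto
  also have "\<dots> = 1 - (1 - p) ^ card ?G"
    by (simp add: Ex_perc_diff Pr_perc_empty finite_box_edges)
  also have "\<dots> < 1"
    using assms by simp
  finally show ?thesis .
qed

text \<open>
  Iterating \<open>leave_prob_recursion\<close> yields geometric decay along the multiples of \<open>k + 1\<close>, where \<open>k\<close> is
  the radius of a box containing \<open>S\<close>. The bound has no constant factor because already \<open>leave_prob 0 p < 1\<close>.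
\<close>

lemma leave_prob_exponential_decay:
  fixes S :: "(int ^ 'd::finite) set"
  assumes p: "0 \<le> p" "p < 1" and S: "finite S" "0 \<in> S" and phi: "phi p S < 1"
  obtains c where "c > 0" "\<And>m. leave_prob TYPE('d) m p \<le> exp (- c * real (Suc m))"
proof -
  let ?\<theta> = "\<lambda>m. leave_prob TYPE('d) m p"
  obtain k where k: "S \<subseteq> lattice_box k"
    using finite_subset_lattice_box[OF S(1)] .
  \<comment> \<open>the lower bound \<open>1 / 2\<close> only serves to make \<open>ln q\<close> meaningful\<close>
  define q where "q = max (1 / 2) (max (phi p S) (?\<theta> 0))"
  have q: "0 < q" "q < 1" "phi p S \<le> q" "?\<theta> 0 \<le> q"
    using phi leave_prob_less_1[OF p] by (auto simp: q_def)
  define c where "c = - ln q / real (Suc k)"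
  have le: "?\<theta> m \<le> q ^ Suc (m div Suc k)" for m
  proof (induction m rule: less_induct)
    case (less m)
    show ?case
    proof (cases "m < Suc k")
      case True
      then have "m div Suc k = 0" by simp
      then show ?thesis
        using leave_prob_antimono[of p 0 m, where 'd = 'd] q p by simp
    next
      case False
      define l where "l = m - Suc k"
      have m: "m = l + Suc k" "l < m"
        using False by (auto simp: l_def)
      have "?\<theta> m \<le> phi p S * ?\<theta> l"
        unfolding m(1) using p k S by (intro leave_prob_recursion) auto
      also have "\<dots> \<le> q * ?\<theta> l"
        using q p by (intro mult_right_mono leave_prob_bounds) auto
      also have "\<dots> \<le> q * q ^ Suc (l div Suc k)"
        using q less.IH[OF m(2)] by (intro mult_left_mono) auto
      also have "m div Suc k = Suc (l div Suc k)"
        unfolding m(1) by (subst div_add_self2) auto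
      then have "q * q ^ Suc (l div Suc k) = q ^ Suc (m div Suc k)"
        by simp
      finally show ?thesis .
    qed
  qed
  have "?\<theta> m \<le> exp (- c * real (Suc m))" for m
  proof -
    have "Suc m \<le> Suc (m div Suc k) * Suc k"
      using dividend_less_div_times[of "Suc k" m] by simp
    then have "real (Suc m) \<le> real (Suc (m div Suc k)) * real (Suc k)"
      unfolding of_nat_mult[symmetric] by (rule of_nat_mono)
    then have "real (Suc m) / real (Suc k) \<le> real (Suc (m div Suc k))"
      by (simp add: divide_le_eq)
    then have "real (Suc (m div Suc k)) * ln q \<le> real (Suc m) / real (Suc k) * ln q"
      using q by (intro mult_right_mono_neg) auto
    also have "\<dots> = - c * real (Suc m)"
      by (simp add: c_def)
    finally have "exp (real (Suc (m div Suc k)) * ln q) \<le> exp (- c * real (Suc m))"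
      by simp
    also have "exp (real (Suc (m div Suc k)) * ln q) = q ^ Suc (m div Suc k)"
      using q by (subst exp_of_nat_mult) simp
    finally show ?thesis
      using le[of m] by simp
  qed
  moreover have "c > 0"
    using q by (simp add: c_def divide_neg_pos)
  ultimately show ?thesis
    using that by blast
qed

section \<open>The differential inequality\<close>

lemma leave_prob_has_derivative:
  assumes p: "0 \<le> p" "p \<le> 1"
    and phi: "\<And>S :: (int ^ 'd::finite) set. finite S \<Longrightarrow> 0 \<in> S \<Longrightarrow> 1 \<le> phi p S"
  obtains D where "(leave_prob TYPE('d) m has_real_derivative D) (at p)"
    and "1 - leave_prob TYPE('d) m p \<le> p * (1 - p) * D"
proof -
  let ?G = "box_edges (Suc m) :: (int ^ 'd) set set"
  let ?A = "\<lambda>\<omega>. \<exists>b\<in>box_boundary (Suc m) :: (int ^ 'd) set. conn \<omega> (lattice_box (Suc m)) 0 b"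
  have eq: "leave_prob TYPE('d) m = (\<lambda>p. Pr_perc p ?G ?A)"
  proof
    fix p
    have "leaves_box m \<omega> = ?A \<omega>" if "\<omega> \<subseteq> ?G" for \<omega>
      using that by (intro leaves_box_iff) (auto simp: box_edges_def)
    then show "leave_prob TYPE('d) m p = Pr_perc p ?G ?A"
      unfolding leave_prob_def by (intro Ex_perc_cong) simp
  qed
  have diff: "lattice_box (Suc m) - box_boundary (Suc m) \<subseteq> (lattice_box m :: (int ^ 'd) set)"
    by (auto simp: box_boundary_def)
  have "1 - Pr_perc p ?G ?A
      \<le> p * (1 - p) * (\<Sum>e\<in>?G. influence p ?G (\<lambda>\<omega>. of_bool (?A \<omega>)) e)"
  proof (rule influence_inequality[OF p finite_box_edges _ finite_lattice_box zero_in_lattice_box])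
    fix S :: "(int ^ 'd) set"
    assume S: "S \<subseteq> lattice_box (Suc m) - box_boundary (Suc m)" "0 \<in> S"
    then have "S \<subseteq> lattice_box m" "finite S"
      using diff finite_lattice_box finite_subset by blast+
    then show "1 \<le> p * (\<Sum>(x, y)\<in>bd_pairs ?G S. Pr_perc p ?G (\<lambda>\<omega>. conn \<omega> S 0 x))"
      using phi[of S] S(2) phi_eq[OF p, of S m "Suc m"] by simp
  qed (auto simp: box_edges_def box_boundary_def)
  moreover have "(leave_prob TYPE('d) m has_real_derivative
      (\<Sum>e\<in>?G. influence p ?G (\<lambda>\<omega>. of_bool (?A \<omega>)) e)) (at p)"
    unfolding eq by (rule Ex_perc_has_derivative[OF finite_box_edges])
  ultimately show ?thesis
    using that unfolding eq by blast
qed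

lemma leave_prob_continuous: "isCont (leave_prob TYPE('d::finite) m) p"
proof -
  have "leave_prob TYPE('d) m = (\<lambda>p. Pr_perc p (box_edges (Suc m) :: (int ^ 'd) set set) (leaves_box m))"
    by (simp add: leave_prob_def fun_eq_iff)
  then show ?thesis
    using Ex_perc_has_derivative[OF finite_box_edges] DERIV_isCont by metis
qed

text \<open>
  The differential inequality says that \<open>(1 - \<theta> x) * x / (1 - x)\<close> is nonincreasing on \<open>(a, 1)\<close>, where
  \<open>\<theta>\<close> is \<open>leave_prob m\<close>. Comparing its values at \<open>p\<close> and at \<open>r > a\<close>, and letting \<open>r\<close> tend to
  \<open>a\<close>, gives the bound for \<open>p < 1\<close>; the case \<open>p = 1\<close> follows by continuity.
\<close>

lemma leave_prob_lower_bound: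
  assumes a: "0 \<le> a" "a < p" "p \<le> 1"
    and phi: "\<And>p (S :: (int ^ 'd::finite) set). a < p \<Longrightarrow> p \<le> 1 \<Longrightarrow> finite S \<Longrightarrow> 0 \<in> S \<Longrightarrow> 1 \<le> phi p S"
  shows "(1 - leave_prob TYPE('d) m p) * p * (1 - a) \<le> (1 - p) * a"
proof -
  let ?\<theta> = "leave_prob TYPE('d) m"
  have 1: "(1 - ?\<theta> q) * q * (1 - r) \<le> (1 - q) * r" if r: "a < r" "r \<le> q" "q < 1" for q r
  proof -
    let ?g = "\<lambda>x. (1 - ?\<theta> x) * (x / (1 - x))"
    have "?g q \<le> ?g r"
    proof (rule DERIV_nonpos_imp_nonincreasing[OF r(2)])
      fix x assume x: "r \<le> x" "x \<le> q"
      then have x01: "0 < x" "x < 1"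
        using a r by auto
      obtain D where D: "(?\<theta> has_real_derivative D) (at x)" "1 - ?\<theta> x \<le> x * (1 - x) * D"
        using leave_prob_has_derivative[of x, where 'd = 'd and m = m] phi x r x01 by (smt (verit))
      let ?d = "- D * (x / (1 - x)) + (1 - ?\<theta> x) * (1 / (1 - x) ^ 2)"
      have "(?g has_real_derivative ?d) (at x)"
        using D(1) x01
        by (auto intro!: derivative_eq_intros simp: power2_eq_square divide_simps) (simp add: algebra_simps)
      moreover have "?d = ((1 - ?\<theta> x) - x * (1 - x) * D) / (1 - x) ^ 2"
        using x01 by (simp add: divide_simps power2_eq_square)
      then have "?d \<le> 0"
        using D(2) by (simp add: divide_nonpos_nonneg)
      ultimately show "\<exists>y. (?g has_real_derivative y) (at x) \<and> y \<le> 0"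
        by blast
    qed
    also have "\<dots> \<le> 1 * (r / (1 - r))"
      using r a leave_prob_bounds[of r, where 'd = 'd] by (intro mult_right_mono) auto
    finally show ?thesis
      using r a by (simp add: field_simps)
  qed
  have 2: "(1 - ?\<theta> q) * q * (1 - a) \<le> (1 - q) * a" if q: "a < q" "q < 1" for q
  proof (rule tendsto_le)
    show "((\<lambda>r. (1 - q) * r) \<longlongrightarrow> (1 - q) * a) (at_right a)"
      "((\<lambda>r. (1 - ?\<theta> q) * q * (1 - r)) \<longlongrightarrow> (1 - ?\<theta> q) * q * (1 - a)) (at_right a)"
      by (intro tendsto_intros)+
    show "\<forall>\<^sub>F r in at_right a. (1 - ?\<theta> q) * q * (1 - r) \<le> (1 - q) * r"
      using eventually_at_right_real[OF q(1)] by eventually_elim (use 1 q in auto)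
  qed simp
  show ?thesis
  proof (cases "p < 1")
    case False
    then have p: "p = 1" using a by simp
    have cont: "(?\<theta> \<longlongrightarrow> ?\<theta> 1) (at_left 1)"
      using leave_prob_continuous[of 1 m, where 'd = 'd] by (simp add: isCont_def filterlim_at_split)
    show ?thesis
      unfolding p
    proof (rule tendsto_le)
      show "((\<lambda>q. (1 - q) * a) \<longlongrightarrow> (1 - 1) * a) (at_left 1)"
        by (intro tendsto_intros)+
      show "((\<lambda>q. (1 - ?\<theta> q) * q * (1 - a)) \<longlongrightarrow> (1 - ?\<theta> 1) * 1 * (1 - a)) (at_left 1)"
        by (intro tendsto_intros cont)
      show "\<forall>\<^sub>F q in at_left 1. (1 - ?\<theta> q) * q * (1 - a) \<le> (1 - q) * a"
        using eventually_at_left_real[of a 1] a p by (auto elim!: eventually_mono intro: 2)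
    qed simp
  qed (use 2 a in auto)
qed

section \<open>Sharpness of the phase transition\<close>

theorem theorem1p1:
  assumes "CARD('d::finite) \<ge> 2"
  shows "p_c_tilde TYPE('d) = p_c TYPE('d) \<and>
    (\<forall>p\<in>{0..1}. p < p_c TYPE('d) \<longrightarrow>
       (\<exists>c>0. \<forall>n\<ge>1.
          percolation_prob p (connected_to_boundary n :: 'd configuration \<Rightarrow> bool)
            \<le> exp (- c * real n))) \<and>
    (\<forall>p\<in>{0..1}. p > p_c TYPE('d) \<longrightarrow>
       percolation_prob p (connected_to_infinity :: 'd configuration \<Rightarrow> bool)
         \<ge> (p - p_c TYPE('d)) / (p * (1 - p_c TYPE('d))))"
proof -
  let ?\<theta> = "\<lambda>p. percolation_prob p (connected_to_infinity :: 'd configuration \<Rightarrow> bool)"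
  define T where "T = {p \<in> {0..1}. \<exists>S :: (int ^ 'd) set. finite S \<and> 0 \<in> S \<and> phi p S < 1}"
  define a where "a = p_c_tilde TYPE('d)"
  have a: "a = Sup T"
    by (simp add: a_def T_def p_c_tilde_def)
  have bdd: "bdd_above T"
    unfolding T_def by (rule bdd_aboveI[of _ 1]) auto
  have T0: "0 \<in> T"
    by (auto simp: T_def phi_def intro!: exI[of _ "{0}"])
  have a01: "0 \<le> a" "a \<le> 1"
    unfolding a using T0 bdd by (auto intro: cSup_upper cSup_least simp: T_def)
  \<comment> \<open>above \<open>a\<close> the differential inequality applies, below \<open>a\<close> the exponential decay\<close>
  have above: "1 \<le> phi p S" if "a < p" "p \<le> 1" "finite S" "0 \<in> S" for p and S :: "(int ^ 'd) set"
  proof (rule ccontr)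
    assume "\<not> 1 \<le> phi p S"
    then have "p \<in> T"
      using that a01 by (auto simp: T_def)
    then show False
      using cSup_upper[OF _ bdd] that(1) a by fastforce
  qed
  have decay: "\<exists>c>0. \<forall>m. leave_prob TYPE('d) m p \<le> exp (- c * real (Suc m))"
    if p: "0 \<le> p" "p < 1" "p < a \<or> p = 0" for p
  proof -
    have "\<exists>q\<in>T. p \<le> q"
      using p(3) T0 less_cSup_iff[of T p] bdd a by (auto intro: less_imp_le)
    then obtain q and S :: "(int ^ 'd) set" where q: "p \<le> q" "q \<le> 1" "finite S" "0 \<in> S" "phi q S < 1"
      by (auto simp: T_def)
    then have "phi p S < 1"
      using phi_mono[of p q S] p by auto
    then show ?thesis
      using leave_prob_exponential_decay[OF p(1,2) q(3,4)] by metis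
  qed
  have sub: "?\<theta> p = 0" if p: "0 \<le> p" "p < 1" "p < a \<or> p = 0" for p
  proof -
    obtain c where c: "c > 0" "\<And>m. leave_prob TYPE('d) m p \<le> exp (- c * real (Suc m))"
      using decay[OF p] by blast
    have "(\<lambda>m. exp (- c * real m)) \<longlonglongrightarrow> 0"
      using c(1) by real_asymp
    then have lim: "(\<lambda>m. exp (- c * real (Suc m))) \<longlonglongrightarrow> 0"
      by (rule LIMSEQ_Suc)
    have "(\<lambda>m. leave_prob TYPE('d) m p) \<longlonglongrightarrow> 0"
    proof (rule tendsto_sandwich[OF _ _ tendsto_const lim])
      show "\<forall>\<^sub>F m in sequentially. 0 \<le> leave_prob TYPE('d) m p"
        using p by (intro always_eventually allI leave_prob_bounds) auto
      show "\<forall>\<^sub>F m in sequentially. leave_prob TYPE('d) m p \<le> exp (- c * real (Suc m))"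
        using c(2) by (intro always_eventually allI)
    qed
    then show ?thesis
      using leave_prob_tendsto[of p, where 'd = 'd] p LIMSEQ_unique by fastforce
  qed
  have sup: "(p - a) / (p * (1 - a)) \<le> ?\<theta> p" if p: "a < p" "p \<le> 1" for p
  proof -
    have "(1 - ?\<theta> p) * p * (1 - a) \<le> (1 - p) * a"
    proof (rule LIMSEQ_le_const2)
      show "(\<lambda>m. (1 - leave_prob TYPE('d) m p) * p * (1 - a)) \<longlonglongrightarrow> (1 - ?\<theta> p) * p * (1 - a)"
        using p a01 by (intro tendsto_intros leave_prob_tendsto) auto
      show "\<exists>N. \<forall>m\<ge>N. (1 - leave_prob TYPE('d) m p) * p * (1 - a) \<le> (1 - p) * a"
        using leave_prob_lower_bound[OF a01(1) p above] by blast
    qed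
    moreover have "0 < p * (1 - a)"
      using p a01 by simp
    ultimately show ?thesis
      by (simp add: pos_divide_le_eq) (simp add: algebra_simps)
  qed
  let ?U = "{p \<in> {0..1}. ?\<theta> p = 0}"
  have U: "0 \<in> ?U" "bdd_above ?U"
    using sub[of 0] by (auto intro: bdd_aboveI[of _ 1])
  have pc: "p_c TYPE('d) = Sup ?U"
    by (simp add: p_c_def)
  have "Sup ?U \<le> a"
  proof (rule cSup_least)
    fix p assume p: "p \<in> ?U"
    show "p \<le> a"
    proof (rule ccontr)
      assume "\<not> p \<le> a"
      then have "0 < (p - a) / (p * (1 - a))"
        using p a01 by auto
      then show False
        using sup[of p] p \<open>\<not> p \<le> a\<close> by simp
    qed
  qed (use U(1) in blast)
  moreover have "a \<le> Sup ?U"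
  proof (rule dense_le)
    fix x assume "x < a"
    show "x \<le> Sup ?U"
    proof (cases "x \<le> 0")
      case True
      then show ?thesis
        using cSup_upper[OF U] by simp
    next
      case False
      then show ?thesis
        using \<open>x < a\<close> a01 sub[of x] by (intro cSup_upper U) auto
    qed
  qed
  ultimately have eq: "p_c TYPE('d) = a"
    using pc by simp
  have "\<exists>c>0. \<forall>n\<ge>1. percolation_prob p (connected_to_boundary n :: 'd configuration \<Rightarrow> bool)
      \<le> exp (- c * real n)" if p: "p \<in> {0..1}" "p < a" for p
  proof -
    obtain c where c: "c > 0" "\<And>m. leave_prob TYPE('d) m p \<le> exp (- c * real (Suc m))"
      using decay[of p] p a01 by auto
    have "percolation_prob p (connected_to_boundary n :: 'd configuration \<Rightarrow> bool) \<le> exp (- c * real n)"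
      if "n \<ge> 1" for n
    proof (cases n)
      case (Suc m)
      then show ?thesis
        using c(2)[of m] p connected_to_boundary_prob[of p m, where 'd = 'd] by simp
    qed (use that in simp)
    then show ?thesis
      using c(1) by blast
  qed
  then show ?thesis
    unfolding eq using sup by (auto simp: a_def)
qed

end
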